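(* Let $1<p\le q<\infty$, let $\omega$ be a weight on $\mathcal H$ with $\omega\in B_p$, and let $\mu$ be a positive measure on $\mathcal H$. Then the following assertions are equivalent. (1) There exists a constant $C_1>0$ such that for any $f\in L_\omega^p(\mathcal H)$, $$\left(\int_{\mathcal H}|M_\omega f(z)|^q\,d\mu(z)\right)^{1/q}\le C_1\|f\|_{p,\omega}.$$ (2) There is a constant $C_2$ such that for any interval $I\subset\mathbb R$, $$\mu(Q_I)\le C_2\,(\omega(Q_I))^{q/p}.$$
   Context: $\mathcal H=\{z=x+iy\in\mathbb C: x\in\mathbb R,\ y>0\}$ is the upper half-plane and $dV$ is Lebesgue measure on $\mathcal H$. A weight is a nonnegative locally integrable function on $\mathcal H$. Intervals $I\subset\mathbb R$ are bounded and of positive length $|I|$. For an interval $I$, $Q_I=\{x+iy: x\in I,\ 0<y<|I|\}$, $|Q_I|=\int_{Q_I}dV$, and $\omega(Q_I)=|Q_I|_\omega=\int_{Q_I}\omega\,dV$. $L^p_\omega(\mathcal H)$ is the set of functions $f$ on $\mathcal H$ with $\|f\|_{p,\omega}^p=\int_{\mathcal H}|f(z)|^p\omega(z)\,dV(z)<\infty$. For $1<p<\infty$, with $pp'=p+p'$, the weight $\omega$ is in the Békollé-Bonami class $B_p$ if $$[\omega]_{B_p}=\sup_{I\subset\mathbb R\ \text{interval}}\left(\frac1{|Q_I|}\int_{Q_I}\omega\,dV\right)\left(\frac1{|Q_I|}\int_{Q_I}\omega^{1-p'}\,dV\right)^{p-1}<\infty.$$ The weighted Hardy-Littlewood maximal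 function is $$M_\omega f(z)=\sup_{I\subset\mathbb R\ \text{interval},\ z\in Q_I}\frac1{\omega(Q_I)}\int_{Q_I}|f|\,\omega\,dV .$$ *)

theory Defs
  imports "HOL-Analysis.Analysis"
begin

definition upper_half_plane :: "complex set" ("\<H>") where
  "\<H> = {z. 0 < Im z}"

(* Intervals may be open, closed or half-open: Q_I is sensitive to the endpoints of I when it is
   measured by a general mu. *)
definition bounded_intervals :: "real set set" where
  "bounded_intervals = {I. is_interval I \<and> bounded I \<and> 0 < measure lborel I}"

definition carleson_box :: "real set \<Rightarrow> complex set" where
  "carleson_box I = {z. Re z \<in> I \<and> 0 < Im z \<and> Im z < measure lborel I}"

(* Real powers in [0,\<infinity>].  Unlike powr on the reals, 0 to a negative power is \<infinity>. *)
definition epowr :: "ennreal \<Rightarrow> real \<Rightarrow> ennreal" (infixr "epowr" 80) where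
  "x epowr r =
     (if r = 0 then 1
      else if x = 0 then (if 0 < r then 0 else \<infinity>)
      else if x = \<infinity> then (if 0 < r then \<infinity> else 0)
      else ennreal (enn2real x powr r))"

definition conj_exponent :: "real \<Rightarrow> real" where
  "conj_exponent p = p / (p - 1)"

lemma conj_exponent_iff:
  assumes "1 < p"
  shows "p * p' = p + p' \<longleftrightarrow> p' = conj_exponent p"
  using assms unfolding conj_exponent_def by (auto simp: field_simps)

(* Only the values on the upper half-plane matter, here and for the functions f below. *)
definition weight :: "(complex \<Rightarrow> real) \<Rightarrow> bool" where
  "weight \<omega> \<longleftrightarrow>
     (\<forall>z\<in>\<H>. 0 \<le> \<omega> z) \<and> (\<forall>K. compact K \<and> K \<subseteq> \<H> \<longrightarrow> \<omega> absolutely_integrable_on K)"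

definition weighted_area :: "(complex \<Rightarrow> real) \<Rightarrow> complex set \<Rightarrow> ennreal" where
  "weighted_area \<omega> A = (\<integral>\<^sup>+z\<in>A. ennreal (\<omega> z) \<partial>lebesgue)"

definition box_average :: "(complex \<Rightarrow> ennreal) \<Rightarrow> real set \<Rightarrow> ennreal" where
  "box_average g I =
     (\<integral>\<^sup>+z\<in>carleson_box I. g z \<partial>lebesgue) / emeasure lebesgue (carleson_box I)"

definition dual_weight :: "real \<Rightarrow> (complex \<Rightarrow> real) \<Rightarrow> complex \<Rightarrow> ennreal" where
  "dual_weight p \<omega> z = ennreal (\<omega> z) epowr (1 - conj_exponent p)"

definition Bp_characteristic :: "real \<Rightarrow> (complex \<Rightarrow> real) \<Rightarrow> ennreal" where
  "Bp_characteristic p \<omega> =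
     (SUP I\<in>bounded_intervals.
        box_average (\<lambda>z. ennreal (\<omega> z)) I * box_average (dual_weight p \<omega>) I epowr (p - 1))"

(* The two averages are required to be finite because 0 * \<infinity> = 0 in ennreal.  This rules out
   nothing but the weight vanishing almost everywhere, for which the product is the undefined
   0 * \<infinity> and the weighted maximal function is 0 / 0. *)
definition Bekolle_Bonami :: "real \<Rightarrow> (complex \<Rightarrow> real) set" where
  "Bekolle_Bonami p =
     {\<omega>. weight \<omega> \<and>
         (\<forall>I\<in>bounded_intervals.
            box_average (\<lambda>z. ennreal (\<omega> z)) I < \<infinity> \<and> box_average (dual_weight p \<omega>) I < \<infinity>) \<and>
         Bp_characteristic p \<omega> < \<infinity>}"

definition wLp_norm :: "real \<Rightarrow> (complex \<Rightarrow> real) \<Rightarrow> (complex \<Rightarrow> complex) \<Rightarrow> ennreal" where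
  "wLp_norm p \<omega> f =
     (\<integral>\<^sup>+z\<in>\<H>. ennreal (cmod (f z)) epowr p * ennreal (\<omega> z) \<partial>lebesgue) epowr (1 / p)"

definition wLp :: "real \<Rightarrow> (complex \<Rightarrow> real) \<Rightarrow> (complex \<Rightarrow> complex) set" where
  "wLp p \<omega> = {f. f \<in> borel_measurable (lebesgue_on \<H>) \<and> wLp_norm p \<omega> f < \<infinity>}"

definition weighted_maximal ::
    "(complex \<Rightarrow> real) \<Rightarrow> (complex \<Rightarrow> complex) \<Rightarrow> complex \<Rightarrow> ennreal" where
  "weighted_maximal \<omega> f z =
     (SUP I\<in>{I \<in> bounded_intervals. z \<in> carleson_box I}.
        (\<integral>\<^sup>+w\<in>carleson_box I. ennreal (cmod (f w)) * ennreal (\<omega> w) \<partial>lebesgue)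
          / weighted_area \<omega> (carleson_box I))"

end

theory Submission
  imports Defs
begin

text \<open>
  Write \<open>\<nu>\<close> for the measure with density \<open>\<omega>\<close> on the upper half-plane and \<open>s = q / p \<ge> 1\<close>.

  That the maximal inequality forces the Carleson condition is seen by testing it on the indicator
  of a box: its maximal function is at least 1 on that box, and the norm of the indicator is
  \<open>\<nu>(Q)\<close> to the power \<open>1 / p\<close>.

  For the converse, the class \<open>B\<^sub>p\<close> enters through \<open>0 < \<nu>(Q\<^sub>I) < \<infinity>\<close> and the doubling property
  \<open>\<nu>(Q\<^sub>J) \<le> D \<nu>(Q\<^sub>I)\<close> for \<open>I \<subseteq> J\<close> with \<open>|J| \<le> 5 |I|\<close> (\<open>Bekolle_Bonami_doubling\<close>). Doubling makes a
  covering argument possible: if \<open>\<nu>(Q) \<le> \<tau>(Q)\<close> for all boxes \<open>Q\<close> of a countable family, the Vitali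
  lemma on the real line selects boxes over disjoint intervals whose fivefold dilates cover the
  union. The Carleson condition bounds the \<open>\<mu>\<close>-measure of the dilates, up to a constant, by the
  sum of the \<open>(D \<tau>(Q))\<^sup>s\<close> over the selected boxes, and since \<open>s \<ge> 1\<close> this is at most the power \<open>s\<close>
  of the sum, which disjointness controls by the total mass of \<open>\<tau>\<close>
  (\<open>emeasure_UN_carleson_boxes_le\<close>).

  Applied to \<open>\<tau> = (2 D / t) |f| 1{|f| > t / (2 D)} d\<nu>\<close>, this bounds \<open>\<mu>\<close> on the set where the
  maximal function exceeds \<open>t\<close> (\<open>weighted_maximal_weak_type\<close>). The truncation of \<open>f\<close> at height \<open>t
  / (2 D)\<close> comes from the trivial bound of the maximal operator on bounded functions. The strong
  inequality follows as in the interpolation theorem of Marcinkiewicz, by summing the weak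
  estimate over the levels \<open>t = 2\<^sup>k\<close> (\<open>nn_integral_epowr_le_of_dyadic_weak_type\<close>).
\<close>

section \<open>Real powers of extended nonnegative reals\<close>

lemma ennreal_epowr:
  assumes "0 \<le> t" "0 < t \<or> 0 < r"
  shows "ennreal t epowr r = ennreal (t powr r)"
  using assms by (auto simp: epowr_def)

lemma epowr_one [simp]: "x epowr 1 = x"
  by (cases x rule: ennreal_cases) (auto simp: epowr_def ennreal_eq_0_iff)

lemma one_epowr [simp]: "1 epowr r = 1"
  by (auto simp: epowr_def)

lemma epowr_mono:
  assumes "x \<le> y" "0 \<le> r" shows "x epowr r \<le> y epowr r"
  using assms
  by (cases x; cases y) (auto simp: epowr_def top_unique intro!: ennreal_leI powr_mono2)

lemma epowr_mult:
  assumes "0 \<le> r" shows "(x * y) epowr r = x epowr r * y epowr r"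
  using assms
  by (cases x; cases y)
     (auto simp: epowr_def ennreal_mult'[symmetric] powr_mult ennreal_mult_top ennreal_top_mult)

lemma epowr_add:
  assumes "0 \<le> a" "0 \<le> b" shows "x epowr (a + b) = x epowr a * x epowr b"
  using assms
  by (cases x) (auto simp: epowr_def ennreal_mult'[symmetric] powr_add)

lemma epowr_epowr:
  assumes "0 \<le> a" "0 \<le> b" shows "(x epowr a) epowr b = x epowr (a * b)"
  using assms
  by (cases x) (auto simp: epowr_def powr_powr)

lemma borel_measurable_epowr [measurable (raw)]:
  assumes [measurable]: "f \<in> borel_measurable M"
  shows "(\<lambda>x. f x epowr r) \<in> borel_measurable M"
  unfolding epowr_def by measurable

text \<open>
  Each summand is at most the total \<open>S\<close>, so \<open>x\<^sub>i\<^sup>s = x\<^sub>i x\<^sub>i\<^sup>s\<^sup>-\<^sup>1 \<le> x\<^sub>i S\<^sup>s\<^sup>-\<^sup>1\<close>. The hypothesis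
  \<open>s \<ge> 1\<close> is what makes the second factor monotone.
\<close>

lemma nn_integral_epowr_le_epowr_nn_integral_count_space:
  assumes "1 \<le> s"
  shows "(\<integral>\<^sup>+i. x i epowr s \<partial>count_space I) \<le> (\<integral>\<^sup>+i. x i \<partial>count_space I) epowr s"
proof -
  let ?S = "\<integral>\<^sup>+i. x i \<partial>count_space I"
  have split: "y epowr s = y * y epowr (s - 1)" for y
    using epowr_add[of 1 "s - 1" y] assms by simp
  have "(\<integral>\<^sup>+i. x i epowr s \<partial>count_space I) \<le> (\<integral>\<^sup>+i. x i * ?S epowr (s - 1) \<partial>count_space I)"
    using assms unfolding split
    by (intro nn_integral_mono mult_left_mono epowr_mono nn_integral_ge_point) auto
  also have "\<dots> = ?S * ?S epowr (s - 1)"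
    by (rule nn_integral_multc) simp
  finally show ?thesis
    unfolding split[of ?S] .
qed

section \<open>From weak type to strong type\<close>

text \<open>
  The terms with \<open>2\<^sup>k < y\<close> form a geometric series descending from its largest term, which is less
  than \<open>y\<^sup>a\<close>.
\<close>

lemma geometric_nn_integral_le:
  fixes a y :: real
  assumes "0 < a" "0 \<le> y"
  shows "(\<integral>\<^sup>+k. ennreal (2 powr (real_of_int k * a)) * indicator {k::int. 2 powr k < y} k \<partial>count_space UNIV)
           \<le> ennreal (y powr a / (1 - 2 powr - a))"
proof (cases "y = 0")
  case True
  then show ?thesis by (simp add: not_less)
next
  case False
  with assms have y: "0 < y" by simp
  \<comment> \<open>The largest integer with \<open>2\<^sup>K < y\<close>, the inequality being strict.\<close>
  define K where "K = \<lceil>log 2 y\<rceil> - 1"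
  have iff: "2 powr k < y \<longleftrightarrow> k \<le> K" for k :: int
  proof -
    have "2 powr k < y \<longleftrightarrow> k < log 2 y" using y by (simp add: less_log_iff)
    also have "\<dots> \<longleftrightarrow> k \<le> K" unfolding K_def by linarith
    finally show ?thesis .
  qed
  have bij: "bij_betw (\<lambda>n. K - int n) UNIV {..K}"
    by (rule bij_betwI[where g = "\<lambda>k. nat (K - k)"]) auto
  define \<rho> where "\<rho> = 2 powr - a"
  have \<rho>: "0 < \<rho>" "\<rho> < 1"
    using assms by (auto simp: \<rho>_def powr_less_one)
  have eq: "2 powr ((K - int n) * a) = 2 powr (K * a) * \<rho> ^ n" for n
    by (simp add: \<rho>_def algebra_simps powr_add[symmetric] powr_realpow[symmetric] powr_powr powr_diff powr_minus divide_simps)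
  have "(\<integral>\<^sup>+k. ennreal (2 powr (real_of_int k * a)) * indicator {k::int. 2 powr k < y} k \<partial>count_space UNIV)
      = (\<integral>\<^sup>+k. ennreal (2 powr (of_int k * a)) \<partial>count_space {..K})"
    unfolding iff by (subst nn_integral_count_space_indicator) (auto simp: atMost_def)
  also have "\<dots> = (\<integral>\<^sup>+n. ennreal (2 powr (of_int (K - int n) * a)) \<partial>count_space UNIV)"
    by (rule nn_integral_bij_count_space[OF bij, symmetric])
  also have "\<dots> = (\<Sum>n. ennreal (2 powr (K * a) * \<rho> ^ n))"
    by (simp add: nn_integral_count_space_nat eq[simplified])
  also have "\<dots> = ennreal (2 powr (K * a) * (1 / (1 - \<rho>)))"
    using \<rho> by (intro suminf_ennreal_eq sums_mult geometric_sums) auto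
  also have "\<dots> \<le> ennreal (y powr a / (1 - \<rho>))"
  proof -
    have "2 powr (K * a) = (2 powr K) powr a" by (simp add: powr_powr)
    also have "\<dots> \<le> y powr a"
      using iff[of K] assms by (intro powr_mono2) auto
    finally show ?thesis
      using \<rho> by (intro ennreal_leI) (simp add: divide_right_mono)
  qed
  finally show ?thesis by (simp add: \<rho>_def)
qed

text \<open>
  A discrete layer-cake inequality. For finite \<open>h > 0\<close>, the single term with \<open>2\<^sup>k < h \<le> 2\<^sup>k\<^sup>+\<^sup>1\<close>
  suffices; for \<open>h = \<infinity>\<close> the terms are unbounded. The level sets enter through a predicate \<open>P\<close> that
  may be larger than \<open>2\<^sup>k < h\<close>, so that a function \<open>h\<close> that is not known to be measurable can be
  handled through measurable supersets of its superlevel sets.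
\<close>

lemma epowr_le_dyadic_sum:
  fixes h :: ennreal and P :: "int \<Rightarrow> bool"
  assumes "0 < q" and P: "\<And>k::int. ennreal (2 powr k) < h \<Longrightarrow> P k"
  shows "h epowr q \<le> (\<integral>\<^sup>+k. ennreal (2 powr ((real_of_int k + 1) * q)) * indicator {k. P k} k \<partial>count_space UNIV)"
    (is "_ \<le> ?S")
proof -
  have summand_le: "ennreal (2 powr ((k + 1) * q)) \<le> ?S" if "ennreal (2 powr k) < h" for k :: int
    using nn_integral_ge_point[of k UNIV
        "\<lambda>k::int. ennreal (2 powr ((k + 1) * q)) * indicator {k. P k} k"] P[OF that] by simp
  show ?thesis
  proof (cases h)
    case (real t)
    show ?thesis
    proof (cases "t = 0")
      case True
      with real assms show ?thesis by (simp add: epowr_def)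
    next
      case False
      with real have t: "0 < t" by simp
      define K where "K = \<lceil>log 2 t\<rceil> - 1"
      have "K < log 2 t" "log 2 t \<le> K + 1" unfolding K_def by linarith+
      then have K: "2 powr K < t" "t \<le> 2 powr (K + 1)"
        using t by (auto simp: less_log_iff log_le_iff)
      have "h epowr q = ennreal (t powr q)"
        using real t by (simp add: ennreal_epowr)
      also have "\<dots> \<le> ennreal ((2 powr (K + 1)) powr q)"
        using K t assms by (intro ennreal_leI powr_mono2) auto
      also have "\<dots> \<le> ?S"
        using summand_le[of K] K real by (simp add: powr_powr ennreal_less_iff)
      finally show ?thesis .
    qed
  next
    case top
    have "ennreal B \<le> ?S" for B
    proof -
      define K where "K = \<lceil>log 2 (max 1 B) / q\<rceil>"
      have "log 2 (max 1 B) / q \<le> K + 1" unfolding K_def by linarith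
      then have "log 2 (max 1 B) \<le> (K + 1) * q" using assms by (simp add: field_simps)
      then have "max 1 B \<le> 2 powr ((K + 1) * q)" by (simp add: log_le_iff)
      then have "ennreal B \<le> ennreal (2 powr ((K + 1) * q))" by (intro ennreal_leI) simp
      also have "\<dots> \<le> ?S" using top by (intro summand_le) simp
      finally show ?thesis .
    qed
    then have all: "ennreal B \<le> ?S" for B .
    have "?S = top"
    proof (cases ?S)
      case (real r)
      with all[of "r + 1"] show ?thesis by (simp del: ennreal_plus)
    qed simp
    then show ?thesis by simp
  qed
qed

text \<open>
  The interpolation step. Let \<open>G\<^sub>k\<close> be the integral of \<open>F\<close> over \<open>{F > c 2\<^sup>k}\<close> and \<open>N\<close> that of
  \<open>F\<^sup>p\<close>. Summing the weak estimates leads to the terms \<open>2\<^sup>k\<^sup>p\<^sup>s (2\<^sup>-\<^sup>k G\<^sub>k)\<^sup>s\<close>. One factor \<open>G\<^sub>k\<close>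
  is kept, while the remaining power \<open>s - 1\<close> of it is estimated by Chebyshev's inequality \<open>G\<^sub>k \<le>
  (c 2\<^sup>k)\<^sup>1\<^sup>-\<^sup>p N\<close>. The exponents of 2 then combine to \<open>k (p - 1)\<close>, and the sum of \<open>2\<^sup>k\<^sup>(\<^sup>p\<^sup>-\<^sup>1\<^sup>)
  G\<^sub>k\<close> is, by exchanging sum and integral, a geometric sum under the integral and comparable to
  \<open>N\<close>.
\<close>

lemma nn_integral_epowr_le_of_dyadic_weak_type:
  fixes F :: "'b \<Rightarrow> real" and h :: "'a \<Rightarrow> ennreal" and E :: "int \<Rightarrow> 'a set"
  assumes p: "1 < p" and s: "1 \<le> s" and c: "0 < c" and A: "0 \<le> A"
    and F [measurable]: "F \<in> borel_measurable \<nu>" and F_nonneg: "\<And>w. 0 \<le> F w"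
    and E [measurable]: "\<And>k. E k \<in> sets \<mu>"
    and superlevel: "\<And>k z. z \<in> space \<mu> \<Longrightarrow> ennreal (2 powr real_of_int k) < h z \<Longrightarrow> z \<in> E k"
    and weak: "\<And>k. emeasure \<mu> (E k) \<le> ennreal A * (ennreal (2 powr - real_of_int k) *
                 (\<integral>\<^sup>+w. ennreal (F w) * indicator {w. c * 2 powr real_of_int k < F w} w \<partial>\<nu>)) epowr s"
  shows "(\<integral>\<^sup>+z. h z epowr (p * s) \<partial>\<mu>)
           \<le> ennreal (A * 2 powr (p * s) * c powr ((1 - p) * s) / (1 - 2 powr - (p - 1)))
               * (\<integral>\<^sup>+w. ennreal (F w powr p) \<partial>\<nu>) epowr s"
proof -
  define N where "N = (\<integral>\<^sup>+w. ennreal (F w powr p) \<partial>\<nu>)"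
  define G where "G k = (\<integral>\<^sup>+w. ennreal (F w) * indicator {w. c * 2 powr real_of_int k < F w} w \<partial>\<nu>)" for k
  define d where "d = 1 - 2 powr - (p - 1)"
  have d: "0 < d" using p by (simp add: d_def powr_less_one)
  have G_le: "G k \<le> ennreal ((c * 2 powr real_of_int k) powr (1 - p)) * N" for k
  proof -
    have "ennreal (F w) * indicator {w. c * 2 powr real_of_int k < F w} w
        \<le> ennreal ((c * 2 powr real_of_int k) powr (1 - p)) * ennreal (F w powr p)" for w
    proof (cases "c * 2 powr real_of_int k < F w")
      case True
      have "0 < c * 2 powr real_of_int k" using c by simp
      with True have pos: "0 < F w" by linarith
      then have "F w = F w powr (1 - p) * F w powr p"
        by (simp add: powr_add[symmetric])
      also have "\<dots> \<le> (c * 2 powr real_of_int k) powr (1 - p) * F w powr p"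
        using True c p by (intro mult_right_mono powr_mono2') auto
      finally show ?thesis
        using True by (simp add: ennreal_mult'[symmetric] ennreal_leI)
    qed simp
    then have "G k \<le> (\<integral>\<^sup>+w. ennreal ((c * 2 powr real_of_int k) powr (1 - p)) * ennreal (F w powr p) \<partial>\<nu>)"
      unfolding G_def by (intro nn_integral_mono)
    then show ?thesis by (simp add: nn_integral_cmult N_def)
  qed
  have split: "x epowr s = x * x epowr (s - 1)" for x
    using epowr_add[of 1 "s - 1" x] s by simp
  define B where "B = A * 2 powr (p * s) * c powr ((1 - p) * (s - 1))"
  have B: "0 \<le> B" using A by (simp add: B_def)
  have summand: "ennreal (2 powr ((real_of_int k + 1) * (p * s))) * emeasure \<mu> (E k)
      \<le> ennreal B * N epowr (s - 1) * (ennreal (2 powr (real_of_int k * (p - 1))) * G k)" for k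
  proof -
    let ?u = "2 powr ((real_of_int k + 1) * (p * s))"
    let ?v = "(2 powr - real_of_int k) powr s"
    let ?w = "((c * 2 powr real_of_int k) powr (1 - p)) powr (s - 1)"
    have exponents: "?u * A * ?v * ?w = B * 2 powr (real_of_int k * (p - 1))"
    proof -
      have "?w = c powr ((1 - p) * (s - 1)) * 2 powr (real_of_int k * ((1 - p) * (s - 1)))"
        using c by (simp add: powr_mult powr_powr mult.assoc)
      moreover have "?u * ?v * 2 powr (real_of_int k * ((1 - p) * (s - 1)))
          = 2 powr (p * s) * 2 powr (real_of_int k * (p - 1))"
        by (simp add: powr_powr powr_add[symmetric] algebra_simps)
      ultimately show ?thesis by (simp add: B_def mult_ac)
    qed
    have "G k epowr (s - 1) \<le> (ennreal ((c * 2 powr real_of_int k) powr (1 - p)) * N) epowr (s - 1)"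
      using s by (intro epowr_mono G_le) simp
    also have "\<dots> = ennreal ?w * N epowr (s - 1)"
      using s c by (simp add: epowr_mult ennreal_epowr)
    finally have Gs: "G k epowr s \<le> G k * (ennreal ?w * N epowr (s - 1))"
      unfolding split[of "G k"] by (intro mult_left_mono) auto
    have "ennreal ?u * emeasure \<mu> (E k)
        \<le> ennreal ?u * (ennreal A * (ennreal (2 powr - real_of_int k) * G k) epowr s)"
      unfolding G_def by (intro mult_left_mono weak) simp
    also have "\<dots> = ennreal ?u * (ennreal A * (ennreal ?v * G k epowr s))"
      using s by (simp add: epowr_mult ennreal_epowr)
    also have "\<dots> \<le> ennreal ?u * (ennreal A * (ennreal ?v * (G k * (ennreal ?w * N epowr (s - 1)))))"
      by (intro mult_left_mono Gs) auto
    also have "\<dots> = ennreal (?u * A * ?v * ?w) * (N epowr (s - 1) * G k)"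
      using A by (simp add: ennreal_mult mult_ac)
    also have "\<dots> = ennreal B * N epowr (s - 1) * (ennreal (2 powr (real_of_int k * (p - 1))) * G k)"
      unfolding exponents using B by (simp add: ennreal_mult mult_ac)
    finally show ?thesis .
  qed
  have sum_G: "(\<integral>\<^sup>+k. ennreal (2 powr (real_of_int k * (p - 1))) * G k \<partial>count_space UNIV)
      \<le> ennreal (c powr (1 - p) / d) * N"
  proof -
    have "(\<integral>\<^sup>+k. ennreal (2 powr (real_of_int k * (p - 1))) * G k \<partial>count_space UNIV)
       = (\<integral>\<^sup>+k. (\<integral>\<^sup>+w. ennreal (2 powr (real_of_int k * (p - 1))) *
            (ennreal (F w) * indicator {w. c * 2 powr real_of_int k < F w} w) \<partial>\<nu>) \<partial>count_space UNIV)"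
      unfolding G_def by (subst nn_integral_cmult) auto
    also have "\<dots> = (\<integral>\<^sup>+w. (\<integral>\<^sup>+k. ennreal (2 powr (real_of_int k * (p - 1))) *
            (ennreal (F w) * indicator {w. c * 2 powr real_of_int k < F w} w) \<partial>count_space UNIV) \<partial>\<nu>)"
      by (rule nn_integral_count_space_nn_integral[symmetric]) auto
    also have "\<dots> \<le> (\<integral>\<^sup>+w. ennreal (c powr (1 - p) / d) * ennreal (F w powr p) \<partial>\<nu>)"
    proof (rule nn_integral_mono)
      fix w
      have "(\<integral>\<^sup>+k. ennreal (2 powr (real_of_int k * (p - 1))) *
            (ennreal (F w) * indicator {w. c * 2 powr real_of_int k < F w} w) \<partial>count_space UNIV)
        = (\<integral>\<^sup>+k. ennreal (F w) * (ennreal (2 powr (real_of_int k * (p - 1))) *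
            indicator {k::int. 2 powr k < F w / c} k) \<partial>count_space UNIV)"
        using c by (intro nn_integral_cong) (auto simp: indicator_def field_simps)
      also have "\<dots> = ennreal (F w) * (\<integral>\<^sup>+k. (ennreal (2 powr (real_of_int k * (p - 1))) *
            indicator {k::int. 2 powr k < F w / c} k) \<partial>count_space UNIV)"
        by (rule nn_integral_cmult) simp
      also have "\<dots> \<le> ennreal (F w) * ennreal ((F w / c) powr (p - 1) / d)"
        unfolding d_def using p c F_nonneg
        by (intro mult_left_mono geometric_nn_integral_le) auto
      also have "\<dots> = ennreal (F w * ((F w / c) powr (p - 1) / d))"
        using d F_nonneg by (intro ennreal_mult[symmetric]) auto
      also have "F w * ((F w / c) powr (p - 1) / d) = c powr (1 - p) / d * F w powr p"
      proof (cases "F w = 0")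
        case False
        with F_nonneg[of w] have pos: "0 < F w" by simp
        have "F w * F w powr (p - 1) = F w powr p"
          using powr_add[of "F w" 1 "p - 1"] pos by simp
        moreover have "inverse (c powr (p - 1)) = c powr (1 - p)"
          by (simp add: powr_minus[symmetric])
        moreover have "(F w / c) powr (p - 1) = F w powr (p - 1) * inverse (c powr (p - 1))"
          using pos c by (subst powr_divide) (auto simp: divide_inverse)
        ultimately show ?thesis by simp
      qed simp
      also have "ennreal (c powr (1 - p) / d * F w powr p)
          = ennreal (c powr (1 - p) / d) * ennreal (F w powr p)"
        using d by (intro ennreal_mult) auto
      finally show "(\<integral>\<^sup>+k. ennreal (2 powr (real_of_int k * (p - 1))) *
            (ennreal (F w) * indicator {w. c * 2 powr real_of_int k < F w} w) \<partial>count_space UNIV)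
          \<le> ennreal (c powr (1 - p) / d) * ennreal (F w powr p)"
        by simp
    qed
    also have "\<dots> = ennreal (c powr (1 - p) / d) * N"
      unfolding N_def by (rule nn_integral_cmult) simp
    finally show ?thesis .
  qed
  have "(\<integral>\<^sup>+z. h z epowr (p * s) \<partial>\<mu>)
      \<le> (\<integral>\<^sup>+z. (\<integral>\<^sup>+k. ennreal (2 powr ((real_of_int k + 1) * (p * s))) *
            indicator (E k) z \<partial>count_space UNIV) \<partial>\<mu>)"
  proof (rule nn_integral_mono)
    fix z assume z: "z \<in> space \<mu>"
    have "h z epowr (p * s) \<le> (\<integral>\<^sup>+k. ennreal (2 powr ((real_of_int k + 1) * (p * s))) *
            indicator {k. z \<in> E k} k \<partial>count_space UNIV)"
      using p s superlevel[OF z] by (intro epowr_le_dyadic_sum) auto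
    then show "h z epowr (p * s) \<le> (\<integral>\<^sup>+k. ennreal (2 powr ((real_of_int k + 1) * (p * s))) *
            indicator (E k) z \<partial>count_space UNIV)"
      by (simp add: indicator_def)
  qed
  also have "\<dots> = (\<integral>\<^sup>+k. (\<integral>\<^sup>+z. ennreal (2 powr ((real_of_int k + 1) * (p * s))) *
            indicator (E k) z \<partial>\<mu>) \<partial>count_space UNIV)"
    by (rule nn_integral_count_space_nn_integral) auto
  also have "\<dots> = (\<integral>\<^sup>+k. ennreal (2 powr ((real_of_int k + 1) * (p * s))) * emeasure \<mu> (E k) \<partial>count_space UNIV)"
    by (simp add: nn_integral_cmult_indicator)
  also have "\<dots> \<le> (\<integral>\<^sup>+k. ennreal B * N epowr (s - 1) * (ennreal (2 powr (real_of_int k * (p - 1))) * G k) \<partial>count_space UNIV)"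
    by (intro nn_integral_mono summand)
  also have "\<dots> = ennreal B * N epowr (s - 1) * (\<integral>\<^sup>+k. ennreal (2 powr (real_of_int k * (p - 1))) * G k \<partial>count_space UNIV)"
    by (rule nn_integral_cmult) simp
  also have "\<dots> \<le> ennreal B * N epowr (s - 1) * (ennreal (c powr (1 - p) / d) * N)"
    by (intro mult_left_mono sum_G) auto
  also have "\<dots> = ennreal (B * (c powr (1 - p) / d)) * N epowr s"
    unfolding split[of N] using B d by (subst ennreal_mult) (auto simp: mult_ac)
  also have "B * (c powr (1 - p) / d) = A * 2 powr (p * s) * c powr ((1 - p) * s) / d"
  proof -
    have "c powr ((1 - p) * (s - 1)) * c powr (1 - p) = c powr ((1 - p) * s)"
      by (simp add: powr_add[symmetric] algebra_simps)
    then show ?thesis by (simp add: B_def mult_ac)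
  qed
  finally show ?thesis by (simp add: N_def d_def)
qed

section \<open>Intervals and Carleson boxes\<close>

lemma bounded_interval_endpoints:
  assumes "I \<in> bounded_intervals"
  obtains l u where "l < u" "{l<..<u} \<subseteq> I" "I \<subseteq> {l..u}" "measure lborel I = u - l"
proof -
  define l u where "l = Inf I" and "u = Sup I"
  have I: "is_interval I" "bounded I" "0 < measure lborel I"
    using assms by (auto simp: bounded_intervals_def)
  then have ne: "I \<noteq> {}" by auto
  have bdd: "bdd_below I" "bdd_above I"
    using I by (auto simp: bounded_imp_bdd_below bounded_imp_bdd_above)
  have sub: "I \<subseteq> {l..u}"
    using bdd by (auto simp: l_def u_def intro: cInf_lower cSup_upper)
  have sup: "{l<..<u} \<subseteq> I"
  proof
    fix x assume "x \<in> {l<..<u}"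
    then have "Inf I < x" "x < Sup I" by (auto simp: l_def u_def)
    then obtain a b where ab: "a \<in> I" "a < x" "b \<in> I" "x < b"
      using cInf_lessD[OF ne, of x] less_cSupD[OF ne, of x] by blast
    have "\<forall>a\<in>I. \<forall>b\<in>I. \<forall>x. a \<le> x \<and> x \<le> b \<longrightarrow> x \<in> I"
      using I(1) unfolding is_interval_1 .
    then have "a \<le> x \<and> x \<le> b \<longrightarrow> x \<in> I"
      using ab(1,3) by (elim ballE allE) auto
    then show "x \<in> I" using ab(2,4) by simp
  qed
  have lu: "l \<le> u" using sub ne by force
  have fin: "{l..u} \<in> fmeasurable lborel"
    using fmeasurable_cbox[of l u] by simp
  have borel: "I \<in> sets borel"
    using I(1) by (rule real_interval_borel_measurable)
  have "measure lborel I \<le> measure lborel {l..u}"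
    using sub fin borel by (intro measure_mono_fmeasurable) auto
  then have le: "measure lborel I \<le> u - l" using lu by simp
  have "I \<in> fmeasurable lborel"
    using fmeasurableI2[OF fin sub] borel by simp
  then have "measure lborel {l<..<u} \<le> measure lborel I"
    by (intro measure_mono_fmeasurable) (use sup in auto)
  then have "u - l \<le> measure lborel I" using lu by simp
  with le I sub sup show ?thesis by (intro that[of l u]) auto
qed

lemma bounded_intervals_borel: "I \<in> bounded_intervals \<Longrightarrow> I \<in> sets borel"
  by (auto simp: bounded_intervals_def intro: real_interval_borel_measurable)

lemma carleson_box_borel [measurable]:
  assumes "I \<in> bounded_intervals" shows "carleson_box I \<in> sets borel"
proof -
  have [measurable]: "I \<in> sets borel" by (rule bounded_intervals_borel[OF assms])
  have "Re \<in> borel_measurable borel" "Im \<in> borel_measurable borel"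
    by (intro borel_measurable_continuous_onI continuous_intros)+
  note [measurable] = this
  have "carleson_box I = {z \<in> space borel. Re z \<in> I \<and> 0 < Im z \<and> Im z < measure lborel I}"
    by (auto simp: carleson_box_def)
  also have "\<dots> \<in> sets borel" by measurable
  finally show ?thesis .
qed

lemma carleson_box_subset_upper_half_plane: "carleson_box I \<subseteq> \<H>"
  by (auto simp: carleson_box_def upper_half_plane_def)

lemma measure_bounded_intervals_mono:
  assumes "I \<in> bounded_intervals" "J \<in> bounded_intervals" "I \<subseteq> J"
  shows "measure lborel I \<le> measure lborel J"
proof -
  obtain l u where "l < u" "{l<..<u} \<subseteq> J" "J \<subseteq> {l..u}" "measure lborel J = u - l"
    by (rule bounded_interval_endpoints[OF assms(2)])
  have fin: "{l..u} \<in> fmeasurable lborel"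
    using fmeasurable_cbox[of l u] by simp
  have "J \<in> fmeasurable lborel"
    using fmeasurableI2[OF fin \<open>J \<subseteq> {l..u}\<close>] bounded_intervals_borel[OF assms(2)] by simp
  then show ?thesis
    using assms bounded_intervals_borel[OF assms(1)] by (intro measure_mono_fmeasurable) auto
qed

lemma carleson_box_mono:
  assumes "I \<in> bounded_intervals" "J \<in> bounded_intervals" "I \<subseteq> J"
  shows "carleson_box I \<subseteq> carleson_box J"
  using measure_bounded_intervals_mono[OF assms] assms(3) by (auto simp: carleson_box_def)

text \<open>
  Whatever the endpoints of \<open>I\<close>, the box lies between an open and a closed square of the same
  side.
\<close>

lemma emeasure_carleson_box:
  assumes "I \<in> bounded_intervals"
  shows "emeasure lebesgue (carleson_box I) = ennreal ((measure lborel I)\<^sup>2)"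
proof -
  obtain l u where lu: "l < u" "{l<..<u} \<subseteq> I" "I \<subseteq> {l..u}" "measure lborel I = u - l"
    by (rule bounded_interval_endpoints[OF assms])
  let ?a = "Complex l 0" and ?b = "Complex u (u - l)"
  have area: "prod ((\<bullet>) (?b - ?a)) Basis = (u - l)\<^sup>2"
    by (simp add: Basis_complex_def power2_eq_square)
  have corner: "\<forall>b\<in>Basis. ?a \<bullet> b \<le> ?b \<bullet> b"
    using lu by (auto simp: Basis_complex_def)
  have [measurable]: "carleson_box I \<in> sets borel" by (rule carleson_box_borel[OF assms])
  have "carleson_box I \<subseteq> cbox ?a ?b" "box ?a ?b \<subseteq> carleson_box I"
    using lu by (auto simp: carleson_box_def in_cbox_complex_iff in_box_complex_iff)
  then have "emeasure lborel (carleson_box I) \<le> emeasure lborel (cbox ?a ?b)"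
    "emeasure lborel (box ?a ?b) \<le> emeasure lborel (carleson_box I)"
    by (auto intro!: emeasure_mono)
  then have "emeasure lborel (carleson_box I) = ennreal ((u - l)\<^sup>2)"
    using corner by (simp add: emeasure_lborel_cbox_eq emeasure_lborel_box_eq area)
  then show ?thesis using lu by simp
qed

lemma measure_ball_real:
  fixes a r :: real
  assumes "0 < r" shows "measure lborel (ball a r) = 2 * r"
  using assms by (simp add: ball_eq_greaterThanLessThan)

lemma ball_in_bounded_intervals:
  fixes a r :: real
  assumes "0 < r" shows "ball a r \<in> bounded_intervals"
  using assms measure_ball_real[OF assms]
  by (auto simp: bounded_intervals_def is_interval_ball_real)

text \<open>
  Rational centres and radii make the family of competing boxes countable, hence their union
  measurable. Enlarging \<open>I\<close> to such a ball at most doubles its length.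
\<close>

lemma subset_rational_ball:
  assumes "I \<in> bounded_intervals"
  obtains a r where "a \<in> \<rat>" "r \<in> \<rat>" "0 < r" "I \<subseteq> ball a r" "r \<le> measure lborel I"
proof -
  obtain l u where lu: "l < u" "{l<..<u} \<subseteq> I" "I \<subseteq> {l..u}" "measure lborel I = u - l"
    by (rule bounded_interval_endpoints[OF assms])
  define L where "L = u - l"
  have L: "0 < L" using lu by (simp add: L_def)
  obtain a where a: "a \<in> \<rat>" "(l + u) / 2 - L / 4 < a" "a < (l + u) / 2 + L / 4"
    using Rats_dense_in_real[of "(l + u) / 2 - L / 4" "(l + u) / 2 + L / 4"] L by auto
  obtain r where r: "r \<in> \<rat>" "3 / 4 * L < r" "r < L"
    using Rats_dense_in_real[of "3 / 4 * L" L] L by auto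
  have "I \<subseteq> ball a r"
  proof
    fix x assume "x \<in> I"
    then have "l \<le> x" "x \<le> u" using lu by auto
    then show "x \<in> ball a r"
      using a r by (auto simp: dist_real_def L_def abs_if field_simps)
  qed
  with a r L lu show ?thesis by (intro that[of a r]) (auto simp: L_def)
qed

section \<open>Covering by Carleson boxes\<close>

lemma emeasure_UN_countable_le:
  assumes "countable I" and [measurable]: "\<And>i. i \<in> I \<Longrightarrow> X i \<in> sets M"
  shows "emeasure M (\<Union>i\<in>I. X i) \<le> (\<integral>\<^sup>+i. emeasure M (X i) \<partial>count_space I)"
proof -
  have [measurable]: "(\<Union>i\<in>I. X i) \<in> sets M"
    using assms by (intro sets.countable_UN') auto
  have "emeasure M (\<Union>i\<in>I. X i) = (\<integral>\<^sup>+z. indicator (\<Union>i\<in>I. X i) z \<partial>M)"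
    by simp
  also have "\<dots> \<le> (\<integral>\<^sup>+z. (\<integral>\<^sup>+i. indicator (X i) z \<partial>count_space I) \<partial>M)"
  proof (rule nn_integral_mono)
    fix z
    show "indicator (\<Union>i\<in>I. X i) z \<le> (\<integral>\<^sup>+i. indicator (X i) z \<partial>count_space I)"
    proof (cases "z \<in> (\<Union>i\<in>I. X i)")
      case True
      then obtain i where i: "i \<in> I" "z \<in> X i" by blast
      then show ?thesis
        using nn_integral_ge_point[of i I "\<lambda>i. indicator (X i) z"] True by simp
    qed simp
  qed
  also have "\<dots> = (\<integral>\<^sup>+i. (\<integral>\<^sup>+z. indicator (X i) z \<partial>M) \<partial>count_space I)"
    using assms by (intro nn_integral_count_space_nn_integral) auto
  also have "\<dots> = (\<integral>\<^sup>+i. emeasure M (X i) \<partial>count_space I)"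
    by (intro nn_integral_cong) auto
  finally show ?thesis .
qed

text \<open>
  The covering estimate. The Vitali lemma requires bounded radii, so it is applied to the boxes
  with radii at most \<open>n\<close>; the bound is independent of \<open>n\<close> and passes to the increasing union.
  Boxes over disjoint intervals are disjoint, and a dilated interval also gives a taller box, so
  the cover of the intervals is a cover of the boxes.
\<close>

lemma emeasure_UN_carleson_boxes_le:
  fixes W :: "complex set \<Rightarrow> ennreal" and K :: "(real \<times> real) set"
  assumes s: "1 \<le> s"
    and sets_\<mu>: "\<And>I. I \<in> bounded_intervals \<Longrightarrow> carleson_box I \<in> sets \<mu>"
    and sets_\<tau>: "\<And>I. I \<in> bounded_intervals \<Longrightarrow> carleson_box I \<in> sets \<tau>"
    and doubling: "\<And>a r. 0 < r \<Longrightarrow>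
          W (carleson_box (ball a (5 * r))) \<le> D * W (carleson_box (ball a r))"
    and carleson: "\<And>I. I \<in> bounded_intervals \<Longrightarrow>
          emeasure \<mu> (carleson_box I) \<le> C * W (carleson_box I) epowr s"
    and K: "countable K" "\<And>a r. (a, r) \<in> K \<Longrightarrow> 0 < r"
    and dominated: "\<And>a r. (a, r) \<in> K \<Longrightarrow>
          W (carleson_box (ball a r)) \<le> emeasure \<tau> (carleson_box (ball a r))"
  shows "emeasure \<mu> (\<Union>(a, r)\<in>K. carleson_box (ball a r))
           \<le> C * (D * emeasure \<tau> (space \<tau>)) epowr s"
proof -
  define Q where "Q = (\<lambda>x::real \<times> real. carleson_box (ball (fst x) (snd x)))"
  define Q5 where "Q5 = (\<lambda>x::real \<times> real. carleson_box (ball (fst x) (5 * snd x)))"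
  have bounded_radii: "emeasure \<mu> (\<Union>x\<in>K'. Q x) \<le> C * (D * emeasure \<tau> (space \<tau>)) epowr s"
    if K': "K' \<subseteq> K" "\<And>x. x \<in> K' \<Longrightarrow> snd x \<le> B" for K' B
  proof -
    have pos: "0 < snd x" if "x \<in> K" for x
      using K(2)[of "fst x" "snd x"] that by simp
    have radii: "\<And>x. x \<in> K' \<Longrightarrow> 0 < snd x \<and> snd x \<le> B"
      using K' pos by blast
    obtain S where S: "countable S" "S \<subseteq> K'"
      "pairwise (\<lambda>i j. disjnt (cball (fst i) (snd i)) (cball (fst j) (snd j))) S"
      "\<And>i. i \<in> K' \<Longrightarrow> \<exists>j. j \<in> S \<and>
                        \<not> disjnt (cball (fst i) (snd i)) (cball (fst j) (snd j)) \<and>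
                        cball (fst i) (snd i) \<subseteq> ball (fst j) (5 * snd j)"
      using Vitali_covering_lemma_cballs_balls[of K' snd B fst] radii by blast
    have S_pos: "0 < snd x" if "x \<in> S" for x
      using that S(2) K'(1) pos by blast
    have Q_\<tau>: "Q x \<in> sets \<tau>" if "x \<in> S" for x
      unfolding Q_def using S_pos[OF that] by (intro sets_\<tau> ball_in_bounded_intervals)
    have Q5_\<mu>: "Q5 x \<in> sets \<mu>" if "x \<in> S" for x
      unfolding Q5_def using S_pos[OF that] by (intro sets_\<mu> ball_in_bounded_intervals) simp
    have disj: "disjoint_family_on Q S"
      unfolding disjoint_family_on_def
    proof (intro ballI impI)
      fix i j assume "i \<in> S" "j \<in> S" "i \<noteq> j"
      then have "disjnt (cball (fst i) (snd i)) (cball (fst j) (snd j))"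
        using S(3) by (simp add: pairwise_def)
      then have "ball (fst i) (snd i) \<inter> ball (fst j) (snd j) = {}"
        using ball_subset_cball[of "fst i" "snd i"] ball_subset_cball[of "fst j" "snd j"]
        unfolding disjnt_def by blast
      then show "Q i \<inter> Q j = {}"
        unfolding Q_def carleson_box_def by blast
    qed
    have cover: "(\<Union>x\<in>K'. Q x) \<subseteq> (\<Union>x\<in>S. Q5 x)"
    proof (rule UN_least)
      fix i assume i: "i \<in> K'"
      then obtain j where j: "j \<in> S" "cball (fst i) (snd i) \<subseteq> ball (fst j) (5 * snd j)"
        using S(4) by blast
      have "ball (fst i) (snd i) \<subseteq> ball (fst j) (5 * snd j)"
        using ball_subset_cball j(2) by (rule order_trans)
      then have "Q i \<subseteq> Q5 j"
        unfolding Q_def Q5_def using radii[OF i] S_pos[OF j(1)]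
        by (intro carleson_box_mono ball_in_bounded_intervals) auto
      then show "Q i \<subseteq> (\<Union>x\<in>S. Q5 x)" using j by blast
    qed
    have "emeasure \<mu> (\<Union>x\<in>K'. Q x) \<le> emeasure \<mu> (\<Union>x\<in>S. Q5 x)"
      using S(1) Q5_\<mu> by (intro emeasure_mono cover sets.countable_UN') auto
    also have "\<dots> \<le> (\<integral>\<^sup>+x. emeasure \<mu> (Q5 x) \<partial>count_space S)"
      using S(1) Q5_\<mu> by (rule emeasure_UN_countable_le)
    also have "\<dots> \<le> (\<integral>\<^sup>+x. C * (D * emeasure \<tau> (Q x)) epowr s \<partial>count_space S)"
    proof (rule nn_integral_mono)
      fix x assume "x \<in> space (count_space S)"
      then have x: "x \<in> S" by simp
      then have xK: "(fst x, snd x) \<in> K" using S(2) K'(1) by auto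
      have "emeasure \<mu> (Q5 x) \<le> C * W (Q5 x) epowr s"
        unfolding Q5_def using S_pos[OF x] by (intro carleson ball_in_bounded_intervals) simp
      also have "\<dots> \<le> C * (D * W (Q x)) epowr s"
        unfolding Q5_def Q_def using s S_pos[OF x]
        by (intro mult_left_mono epowr_mono doubling) auto
      also have "\<dots> \<le> C * (D * emeasure \<tau> (Q x)) epowr s"
        unfolding Q_def using s xK by (intro mult_left_mono epowr_mono dominated) auto
      finally show "emeasure \<mu> (Q5 x) \<le> C * (D * emeasure \<tau> (Q x)) epowr s" .
    qed
    also have "\<dots> = C * (\<integral>\<^sup>+x. (D * emeasure \<tau> (Q x)) epowr s \<partial>count_space S)"
      by (rule nn_integral_cmult) simp
    also have "\<dots> \<le> C * (\<integral>\<^sup>+x. D * emeasure \<tau> (Q x) \<partial>count_space S) epowr s"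
      using s by (intro mult_left_mono nn_integral_epowr_le_epowr_nn_integral_count_space) auto
    also have "(\<integral>\<^sup>+x. D * emeasure \<tau> (Q x) \<partial>count_space S)
        = D * (\<integral>\<^sup>+x. emeasure \<tau> (Q x) \<partial>count_space S)"
      by (rule nn_integral_cmult) simp
    also have "(\<integral>\<^sup>+x. emeasure \<tau> (Q x) \<partial>count_space S) = emeasure \<tau> (\<Union>x\<in>S. Q x)"
      using S(1) disj Q_\<tau> by (intro emeasure_UN_countable[symmetric]) auto
    also have "C * (D * emeasure \<tau> (\<Union>x\<in>S. Q x)) epowr s \<le> C * (D * emeasure \<tau> (space \<tau>)) epowr s"
      using s by (intro mult_left_mono epowr_mono emeasure_space) auto
    finally show ?thesis .
  qed
  define U where "U n = (\<Union>x\<in>{x\<in>K. snd x \<le> real n}. Q x)" for n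
  have "(\<Union>(a, r)\<in>K. carleson_box (ball a r)) = (\<Union>x\<in>K. Q x)"
    by (simp add: Q_def case_prod_beta)
  also have "\<dots> = (\<Union>n. U n)"
    unfolding U_def using real_arch_simple by blast
  also have "emeasure \<mu> (\<Union>n. U n) = (SUP n. emeasure \<mu> (U n))"
  proof (rule SUP_emeasure_incseq[symmetric])
    have "Q x \<in> sets \<mu>" if "x \<in> K" for x
      unfolding Q_def using K(2)[of "fst x" "snd x"] that
      by (intro sets_\<mu> ball_in_bounded_intervals) simp
    then show "range U \<subseteq> sets \<mu>"
      unfolding U_def using K(1) by (auto intro!: sets.countable_UN')
    show "incseq U"
      unfolding U_def incseq_def by (intro allI impI UN_mono) auto
  qed
  also have "\<dots> \<le> C * (D * emeasure \<tau> (space \<tau>)) epowr s"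
    unfolding U_def by (intro SUP_least bounded_radii) auto
  finally show ?thesis .
qed

section \<open>Doubling of Bekolle-Bonami weights\<close>

text \<open>
  Local integrability gives measurability on compact sets, and countably many compact rectangles
  exhaust the half-plane.
\<close>

lemma weight_borel_measurable:
  assumes "weight \<omega>"
  shows "(\<lambda>z. ennreal (\<omega> z) * indicator \<H> z) \<in> borel_measurable lebesgue"
proof -
  define K where "K n = cbox (Complex (- real n) (1 / real n)) (Complex (real n) (real n))" for n
  have K_subset: "K n \<subseteq> \<H>" if "0 < n" for n
  proof
    fix z assume "z \<in> K n"
    then have "1 / real n \<le> Im z" by (simp add: K_def in_cbox_complex_iff)
    moreover have "0 < 1 / real n" using that by simp
    ultimately show "z \<in> \<H>" unfolding upper_half_plane_def by (simp only: mem_Collect_eq)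
  qed
  have meas: "(\<lambda>z. indicator (K n) z * \<omega> z) \<in> borel_measurable lebesgue" if "0 < n" for n
  proof -
    have "compact (K n)" unfolding K_def by (rule compact_cbox)
    then have "\<omega> absolutely_integrable_on K n"
      using assms K_subset[OF that] by (auto simp: weight_def)
    then have "integrable lebesgue (\<lambda>z. indicator (K n) z *\<^sub>R \<omega> z)"
      by (simp add: set_integrable_def)
    then show ?thesis by (auto dest: borel_measurable_integrable)
  qed
  have "(\<lambda>z. indicator \<H> z * \<omega> z) \<in> borel_measurable lebesgue"
  proof (rule borel_measurable_LIMSEQ_real)
    show "(\<lambda>z. indicator (K (Suc n)) z * \<omega> z) \<in> borel_measurable lebesgue" for n
      by (rule meas) simp
    fix z :: complex
    have "eventually (\<lambda>n. indicator (K (Suc n)) z * \<omega> z = indicator \<H> z * \<omega> z) sequentially"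
    proof (cases "z \<in> \<H>")
      case True
      then have y: "0 < Im z" by (simp add: upper_half_plane_def)
      obtain m where m: "max \<bar>Re z\<bar> (max (Im z) (1 / Im z)) \<le> real m"
        using real_arch_simple by blast
      have "z \<in> K (Suc n)" if "m \<le> n" for n
      proof -
        have "real m \<le> real (Suc n)" using that by simp
        then have *: "\<bar>Re z\<bar> \<le> real (Suc n)" "Im z \<le> real (Suc n)" "1 / Im z \<le> real (Suc n)"
          using m by linarith+
        then have "1 / real (Suc n) \<le> Im z" using y by (simp add: field_simps)
        with * show ?thesis by (auto simp: K_def in_cbox_complex_iff)
      qed
      then show ?thesis
        using True by (intro eventually_sequentiallyI[of m]) simp
    next
      case False
      have "z \<notin> K (Suc n)" for n using K_subset[of "Suc n"] False by auto
      then show ?thesis using False by simp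
    qed
    then show "(\<lambda>n. indicator (K (Suc n)) z * \<omega> z) \<longlonglongrightarrow> indicator \<H> z * \<omega> z"
      by (rule tendsto_eventually)
  qed
  then have "(\<lambda>z. ennreal (indicator \<H> z * \<omega> z)) \<in> borel_measurable lebesgue"
    by measurable
  also have "(\<lambda>z. ennreal (indicator \<H> z * \<omega> z)) = (\<lambda>z. ennreal (\<omega> z) * indicator \<H> z)"
    by (auto simp: indicator_def)
  finally show ?thesis .
qed

lemma weight_borel_measurable_carleson_box:
  assumes "weight \<omega>" "I \<in> bounded_intervals"
  shows "(\<lambda>z. ennreal (\<omega> z) * indicator (carleson_box I) z) \<in> borel_measurable lebesgue"
    and "(\<lambda>z. dual_weight p \<omega> z * indicator (carleson_box I) z) \<in> borel_measurable lebesgue"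
proof -
  note [measurable] = weight_borel_measurable[OF assms(1)]
  have [measurable]: "carleson_box I \<in> sets lebesgue"
    using carleson_box_borel[OF assms(2)] by simp
  have "(\<lambda>z. ennreal (\<omega> z) * indicator \<H> z * indicator (carleson_box I) z)
      \<in> borel_measurable lebesgue"
    by measurable
  also have "(\<lambda>z. ennreal (\<omega> z) * indicator \<H> z * indicator (carleson_box I) z)
      = (\<lambda>z. ennreal (\<omega> z) * indicator (carleson_box I) z)"
    using carleson_box_subset_upper_half_plane[of I] by (intro ext) (auto split: split_indicator)
  finally show "(\<lambda>z. ennreal (\<omega> z) * indicator (carleson_box I) z) \<in> borel_measurable lebesgue" .
  have "(\<lambda>z. (ennreal (\<omega> z) * indicator \<H> z) epowr (1 - conj_exponent p) * indicator (carleson_box I) z)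
      \<in> borel_measurable lebesgue"
    by measurable
  also have "(\<lambda>z. (ennreal (\<omega> z) * indicator \<H> z) epowr (1 - conj_exponent p) * indicator (carleson_box I) z)
      = (\<lambda>z. dual_weight p \<omega> z * indicator (carleson_box I) z)"
    using carleson_box_subset_upper_half_plane[of I]
    by (intro ext) (auto simp: dual_weight_def split: split_indicator)
  finally show "(\<lambda>z. dual_weight p \<omega> z * indicator (carleson_box I) z) \<in> borel_measurable lebesgue" .
qed

text \<open>
  The dual weight is \<open>\<omega>\<close> to the power \<open>- 1 / (p - 1)\<close>, so the second summand is \<open>(t \<omega>)\<close> to a
  negative power: of the two summands, the first is at least 1 where \<open>t \<omega> \<ge> 1\<close> and the second
  elsewhere. With a free parameter \<open>t\<close> this replaces Hoelder's inequality.
\<close>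

lemma one_le_weight_plus_dual_weight:
  assumes "1 < p" "0 < t"
  shows "1 \<le> ennreal t * ennreal (\<omega> z) + ennreal (t powr (- 1 / (p - 1))) * dual_weight p \<omega> z"
proof (cases "1 \<le> t * \<omega> z")
  case True
  then have "1 \<le> ennreal t * ennreal (\<omega> z)"
    using assms by (simp add: ennreal_mult'[symmetric] ennreal_1[symmetric] del: ennreal_1)
  then show ?thesis by (rule add_increasing2[rotated]) simp
next
  case False
  have exponent: "1 - conj_exponent p = - 1 / (p - 1)"
    using assms by (simp add: conj_exponent_def field_simps)
  have neg: "- 1 / (p - 1) < 0" using assms by simp
  have "1 \<le> ennreal (t powr (- 1 / (p - 1))) * dual_weight p \<omega> z"
  proof (cases "0 < \<omega> z")
    case True
    have "1 \<le> (t * \<omega> z) powr (- 1 / (p - 1))"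
      using False True assms neg powr_mono2'[of "- 1 / (p - 1)" "t * \<omega> z" 1] by simp
    then show ?thesis
      using True assms
      by (simp add: dual_weight_def exponent ennreal_epowr ennreal_mult'[symmetric] powr_mult
          ennreal_1[symmetric] del: ennreal_1)
  next
    case False
    then have "dual_weight p \<omega> z = \<infinity>"
      using neg by (simp add: dual_weight_def exponent epowr_def ennreal_neg)
    then show ?thesis using assms by (simp add: ennreal_mult_top)
  qed
  then show ?thesis by (rule add_increasing[rotated]) simp
qed

text \<open>
  Integrating the pointwise inequality above over \<open>Q\<^sub>I\<close> and enlarging the domain of the dual
  weight to \<open>Q\<^sub>J\<close> gives \<open>|Q\<^sub>I| \<le> t \<omega>(Q\<^sub>I) + t powr (- 1 / (p - 1)) * \<sigma>(Q\<^sub>J)\<close>, where \<open>\<sigma>\<close> has the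
  dual weight as density. For the \<open>t\<close> that makes the last term equal to \<open>|Q\<^sub>I| / 2\<close>, this is a
  lower bound for \<open>\<omega>(Q\<^sub>I)\<close> in terms of \<open>\<sigma>(Q\<^sub>J)\<close>, and the \<open>B\<^sub>p\<close> condition on \<open>Q\<^sub>J\<close> converts it into
  a multiple of \<open>\<omega>(Q\<^sub>J)\<close>. The same lower bound shows \<open>\<omega>(Q\<^sub>I) > 0\<close>.
\<close>

lemma Bekolle_Bonami_doubling:
  assumes p: "1 < p" and \<omega>: "\<omega> \<in> Bekolle_Bonami p"
  obtains D :: real where "0 < D"
    and "\<And>I J. I \<in> bounded_intervals \<Longrightarrow> J \<in> bounded_intervals \<Longrightarrow> I \<subseteq> J
            \<Longrightarrow> measure lborel J \<le> 5 * measure lborel I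
            \<Longrightarrow> weighted_area \<omega> (carleson_box J) \<le> ennreal D * weighted_area \<omega> (carleson_box I)"
    and "\<And>I. I \<in> bounded_intervals \<Longrightarrow> 0 < weighted_area \<omega> (carleson_box I)"
    and "\<And>I. I \<in> bounded_intervals \<Longrightarrow> weighted_area \<omega> (carleson_box I) < \<infinity>"
proof -
  have weight: "weight \<omega>" using \<omega> by (simp add: Bekolle_Bonami_def)
  define W where "W I = weighted_area \<omega> (carleson_box I)" for I
  define S where "S I = (\<integral>\<^sup>+z\<in>carleson_box I. dual_weight p \<omega> z \<partial>lebesgue)" for I
  define len where "len I = measure lborel I" for I :: "real set"
  have len: "0 < len I" if "I \<in> bounded_intervals" for I
    using that by (simp add: bounded_intervals_def len_def)
  have averages: "box_average (\<lambda>z. ennreal (\<omega> z)) I = W I / ennreal ((len I)\<^sup>2)"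
    "box_average (dual_weight p \<omega>) I = S I / ennreal ((len I)\<^sup>2)"
    if "I \<in> bounded_intervals" for I
    by (simp_all only: box_average_def W_def weighted_area_def S_def len_def
          emeasure_carleson_box[OF that])
  have finite: "W I < \<infinity>" "S I < \<infinity>" if I: "I \<in> bounded_intervals" for I
  proof -
    have "W I / ennreal ((len I)\<^sup>2) < \<infinity>" "S I / ennreal ((len I)\<^sup>2) < \<infinity>"
      using \<omega> I by (auto simp: Bekolle_Bonami_def averages[symmetric])
    moreover have "x < \<infinity>" if "x / ennreal c < \<infinity>" for x c
      using that by (cases x) (auto simp: ennreal_top_divide)
    ultimately show "W I < \<infinity>" "S I < \<infinity>" by blast+
  qed
  define w where "w I = enn2real (W I)" for I
  define \<sigma> where "\<sigma> I = enn2real (S I)" for I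
  have real: "W I = ennreal (w I)" "S I = ennreal (\<sigma> I)" if "I \<in> bounded_intervals" for I
    using finite[OF that] by (auto simp: w_def \<sigma>_def less_top)
  have nonneg: "0 \<le> w I" "0 \<le> \<sigma> I" for I by (auto simp: w_def \<sigma>_def)
  define b where "b = enn2real (Bp_characteristic p \<omega>)"
  have b: "Bp_characteristic p \<omega> = ennreal b" "0 \<le> b"
    using \<omega> by (auto simp: Bekolle_Bonami_def b_def less_top)
  have Bp: "w I / (len I)\<^sup>2 * (\<sigma> I / (len I)\<^sup>2) powr (p - 1) \<le> b" if I: "I \<in> bounded_intervals" for I
  proof -
    have "W I / ennreal ((len I)\<^sup>2) * (S I / ennreal ((len I)\<^sup>2)) epowr (p - 1) \<le> ennreal b"
      unfolding b(1)[symmetric] Bp_characteristic_def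
      using I by (intro SUP_upper2[of I]) (auto simp: averages)
    then show ?thesis
      using p len[OF I] nonneg b(2)
      by (simp add: real[OF I] divide_ennreal ennreal_epowr ennreal_mult'[symmetric])
  qed
  have area: "(len I)\<^sup>2 \<le> t * w I + t powr (- 1 / (p - 1)) * \<sigma> J"
    if I: "I \<in> bounded_intervals" and J: "J \<in> bounded_intervals" and "I \<subseteq> J" and "0 < t" for I J t
  proof -
    let ?u = "t powr (- 1 / (p - 1))"
    have sub: "carleson_box I \<subseteq> carleson_box J" by (rule carleson_box_mono) fact+
    note [measurable] = weight_borel_measurable_carleson_box[OF weight I]
    have [measurable]: "carleson_box I \<in> sets lebesgue" using carleson_box_borel[OF I] by simp
    have "ennreal ((len I)\<^sup>2) = (\<integral>\<^sup>+z. indicator (carleson_box I) z \<partial>lebesgue)"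
      using emeasure_carleson_box[OF I] by (simp add: len_def)
    also have "\<dots> \<le> (\<integral>\<^sup>+z. ennreal t * (ennreal (\<omega> z) * indicator (carleson_box I) z)
        + ennreal ?u * (dual_weight p \<omega> z * indicator (carleson_box I) z) \<partial>lebesgue)"
      using one_le_weight_plus_dual_weight[OF p \<open>0 < t\<close>]
      by (intro nn_integral_mono) (auto simp: indicator_def)
    also have "\<dots> = ennreal t * W I + ennreal ?u * S I"
      by (subst nn_integral_add; (subst nn_integral_cmult)?)
         (auto simp: W_def S_def weighted_area_def nn_integral_cmult)
    also have "\<dots> \<le> ennreal t * W I + ennreal ?u * S J"
      unfolding S_def using sub
      by (intro add_left_mono mult_left_mono nn_integral_mono) (auto simp: indicator_def)
    also have "\<dots> = ennreal (t * w I + ?u * \<sigma> J)"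
      using \<open>0 < t\<close> nonneg by (simp add: real[OF I] real[OF J] ennreal_mult')
    finally show ?thesis
      using \<open>0 < t\<close> nonneg by (subst (asm) ennreal_le_iff) auto
  qed
  \<comment> \<open>If \<open>\<sigma>(Q\<^sub>J)\<close> were 0, then \<open>|Q\<^sub>J| \<le> t \<omega>(Q\<^sub>J)\<close> for every \<open>t > 0\<close>, however small.\<close>
  have \<sigma>_pos: "0 < \<sigma> J" if J: "J \<in> bounded_intervals" for J
  proof (rule ccontr)
    assume "\<not> 0 < \<sigma> J"
    then have 0: "\<sigma> J = 0" using nonneg[of J] by simp
    define t where "t = (len J)\<^sup>2 / (2 * (w J + 1))"
    have t: "0 < t" using len[OF J] nonneg(1)[of J] by (simp add: t_def)
    have "t * w J \<le> t * (w J + 1)" using t by simp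
    also have "\<dots> = (len J)\<^sup>2 / 2"
      using nonneg(1)[of J] by (simp add: t_def field_simps add_nonneg_eq_0_iff)
    finally have "t * w J \<le> (len J)\<^sup>2 / 2" .
    moreover have "(len J)\<^sup>2 \<le> t * w J"
      using area[OF J J order_refl t] by (simp add: 0)
    moreover have "0 < (len J)\<^sup>2" using len[OF J] by simp
    ultimately show False by linarith
  qed
  have key: "(len I)\<^sup>2 / 2 \<le> (2 * \<sigma> J / (len I)\<^sup>2) powr (p - 1) * w I"
    if I: "I \<in> bounded_intervals" and J: "J \<in> bounded_intervals" and "I \<subseteq> J" for I J
  proof -
    \<comment> \<open>The choice \<open>t = x powr (p - 1)\<close> makes the second summand equal to \<open>|Q\<^sub>I| / 2\<close>.\<close>
    define x where "x = 2 * \<sigma> J / (len I)\<^sup>2"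
    have x: "0 < x" using \<sigma>_pos[OF J] len[OF I] by (simp add: x_def)
    have "(x powr (p - 1)) powr (- 1 / (p - 1)) = x powr - 1"
      unfolding powr_powr using p by simp
    also have "\<dots> = 1 / x" using x by (simp add: powr_minus_divide)
    finally have "(x powr (p - 1)) powr (- 1 / (p - 1)) * \<sigma> J = (len I)\<^sup>2 / 2"
      using \<sigma>_pos[OF J] len[OF I] by (simp add: x_def)
    moreover have "(len I)\<^sup>2 \<le> x powr (p - 1) * w I
        + (x powr (p - 1)) powr (- 1 / (p - 1)) * \<sigma> J"
      using x by (intro area that) simp
    ultimately have "(len I)\<^sup>2 / 2 \<le> x powr (p - 1) * w I" by linarith
    then show ?thesis by (simp only: x_def)
  qed
  have doubling: "w J \<le> (b * 50 powr p + 1) * w I"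
    if I: "I \<in> bounded_intervals" and J: "J \<in> bounded_intervals" and "I \<subseteq> J"
      and len_le: "measure lborel J \<le> 5 * measure lborel I" for I J
  proof -
    define X where "X = (len I)\<^sup>2"
    define Y where "Y = (len J)\<^sup>2"
    have X: "0 < X" and Y: "0 < Y" using len[OF I] len[OF J] by (auto simp: X_def Y_def)
    \<comment> \<open>The areas differ by a factor of at most 25; the factor \<open>1 / 2\<close> lost above turns it into 50.\<close>
    have YX: "Y \<le> 25 * X"
      using power_mono[OF len_le, of 2] by (simp add: X_def Y_def len_def power_mult_distrib)
    have X_powr: "X * X powr (p - 1) = X powr p" and Y_powr: "Y * Y powr (p - 1) = Y powr p"
      using X Y powr_add[of X 1 "p - 1"] powr_add[of Y 1 "p - 1"] by auto
    have two_powr: "2 * 2 powr (p - 1) = (2::real) powr p"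
      using powr_add[of 2 1 "p - 1"] by simp
    have upper: "w J * \<sigma> J powr (p - 1) \<le> b * Y powr p"
    proof -
      have "w J / Y * (\<sigma> J powr (p - 1) / Y powr (p - 1)) \<le> b"
        using Bp[OF J] nonneg Y by (simp add: Y_def powr_divide)
      then show ?thesis using Y by (simp add: Y_powr[symmetric] field_simps)
    qed
    have lower: "X powr p \<le> 2 powr p * \<sigma> J powr (p - 1) * w I"
    proof -
      have "X / 2 \<le> 2 powr (p - 1) * \<sigma> J powr (p - 1) / X powr (p - 1) * w I"
        using key[OF that(1-3)] nonneg X by (simp add: X_def powr_divide powr_mult)
      then have "X * X powr (p - 1) \<le> 2 * 2 powr (p - 1) * \<sigma> J powr (p - 1) * w I"
        using X by (simp add: field_simps)
      then show ?thesis by (simp only: X_powr two_powr)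
    qed
    have "w J * X powr p \<le> w J * (2 powr p * \<sigma> J powr (p - 1) * w I)"
      using lower nonneg(1) by (rule mult_left_mono)
    also have "\<dots> = w J * \<sigma> J powr (p - 1) * (2 powr p * w I)"
      by (simp add: mult_ac)
    also have "\<dots> \<le> b * Y powr p * (2 powr p * w I)"
      using upper by (rule mult_right_mono) (simp add: nonneg)
    also have "\<dots> \<le> b * (25 * X) powr p * (2 powr p * w I)"
      using YX Y p b nonneg by (intro mult_right_mono mult_left_mono powr_mono2) auto
    also have "\<dots> = (b * 50 powr p * w I) * X powr p"
      using X powr_mult[of 25 2 p] by (simp add: powr_mult mult_ac)
    finally have "w J \<le> b * 50 powr p * w I"
      using X by simp
    then show ?thesis using nonneg[of I] by (simp add: algebra_simps)
  qed
  show ?thesis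
  \<comment> \<open>The summand 1 keeps the constant positive, as \<open>b\<close> is only known to be nonnegative.\<close>
  proof (rule that[of "b * 50 powr p + 1"])
    show pos: "0 < b * 50 powr p + 1" using b by (simp add: add_nonneg_pos)
    fix I :: "real set" assume I: "I \<in> bounded_intervals"
    show "weighted_area \<omega> (carleson_box I) < \<infinity>"
      using finite[OF I] by (simp add: W_def)
    have "0 < (len I)\<^sup>2 / 2" using len[OF I] by simp
    then have "w I \<noteq> 0" using key[OF I I order_refl] by (auto simp: not_less)
    then show "0 < weighted_area \<omega> (carleson_box I)"
      using real(1)[OF I] nonneg(1)[of I] by (simp add: W_def)
    fix J :: "real set" assume J: "J \<in> bounded_intervals" "I \<subseteq> J"
      "measure lborel J \<le> 5 * measure lborel I"
    have "W J \<le> ennreal ((b * 50 powr p + 1) * w I)"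
      unfolding real(1)[OF J(1)] by (intro ennreal_leI doubling I J)
    then show "weighted_area \<omega> (carleson_box J)
        \<le> ennreal (b * 50 powr p + 1) * weighted_area \<omega> (carleson_box I)"
      using pos by (simp add: W_def[symmetric] real(1)[OF I] ennreal_mult')
  qed
qed

section \<open>The measure with density \<open>\<omega>\<close> and zero extensions\<close>

text \<open>
  A measure on all of \<open>\<complex>\<close>, null off the half-plane, so that boxes and integrands can be treated
  without restricting measure spaces.
\<close>

definition weighted_measure :: "(complex \<Rightarrow> real) \<Rightarrow> complex measure" where
  "weighted_measure \<omega> = density lebesgue (\<lambda>z. ennreal (\<omega> z) * indicator \<H> z)"

definition zero_extended_cmod :: "(complex \<Rightarrow> complex) \<Rightarrow> complex \<Rightarrow> real" where
  "zero_extended_cmod f z = cmod (if z \<in> \<H> then f z else 0)"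

lemma upper_half_plane_lebesgue [measurable]: "\<H> \<in> sets lebesgue"
proof -
  have "open \<H>" unfolding upper_half_plane_def by (rule open_halfspace_Im_gt)
  then have "\<H> \<in> sets borel" by (rule borel_open)
  then show ?thesis by simp
qed

lemma sets_weighted_measure [simp, measurable_cong]: "sets (weighted_measure \<omega>) = sets lebesgue"
  by (simp add: weighted_measure_def)

lemma carleson_box_lebesgue [measurable]:
  "I \<in> bounded_intervals \<Longrightarrow> carleson_box I \<in> sets lebesgue"
  using carleson_box_borel by simp

lemma zero_extended_cmod_nonneg: "0 \<le> zero_extended_cmod f z"
  by (simp add: zero_extended_cmod_def)

lemma zero_extended_cmod_borel_measurable:
  assumes "f \<in> borel_measurable (lebesgue_on \<H>)"
  shows "zero_extended_cmod f \<in> borel_measurable lebesgue"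
proof -
  have [measurable]: "(\<lambda>z. if z \<in> \<H> then f z else 0) \<in> borel_measurable lebesgue"
    using assms by (simp add: borel_measurable_if)
  show ?thesis unfolding zero_extended_cmod_def by measurable
qed

lemma nn_integral_weighted_measure:
  assumes "weight \<omega>" "g \<in> borel_measurable lebesgue"
  shows "(\<integral>\<^sup>+z. g z \<partial>weighted_measure \<omega>) = (\<integral>\<^sup>+z\<in>\<H>. g z * ennreal (\<omega> z) \<partial>lebesgue)"
  unfolding weighted_measure_def
  by (subst nn_integral_density)
     (use weight_borel_measurable[OF assms(1)] assms(2) in \<open>auto simp: mult_ac\<close>)

lemma emeasure_weighted_measure_carleson_box:
  assumes "weight \<omega>" and I: "I \<in> bounded_intervals"
  shows "emeasure (weighted_measure \<omega>) (carleson_box I) = weighted_area \<omega> (carleson_box I)"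
  unfolding weighted_measure_def weighted_area_def
  using weight_borel_measurable[OF assms(1)] carleson_box_lebesgue[OF I]
    carleson_box_subset_upper_half_plane[of I]
  by (subst emeasure_density) (auto intro!: nn_integral_cong split: split_indicator)

lemma nn_integral_weighted_measure_carleson_box:
  assumes "weight \<omega>" "f \<in> borel_measurable (lebesgue_on \<H>)" "I \<in> bounded_intervals"
  shows "(\<integral>\<^sup>+z\<in>carleson_box I. ennreal (cmod (f z)) * ennreal (\<omega> z) \<partial>lebesgue)
      = (\<integral>\<^sup>+z\<in>carleson_box I. ennreal (zero_extended_cmod f z) \<partial>weighted_measure \<omega>)"
proof -
  note [measurable] = zero_extended_cmod_borel_measurable[OF assms(2)] carleson_box_lebesgue[OF assms(3)]
  have "(\<integral>\<^sup>+z\<in>carleson_box I. ennreal (zero_extended_cmod f z) \<partial>weighted_measure \<omega>)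
     = (\<integral>\<^sup>+z\<in>\<H>. ennreal (zero_extended_cmod f z) * indicator (carleson_box I) z * ennreal (\<omega> z) \<partial>lebesgue)"
    by (rule nn_integral_weighted_measure[OF assms(1)]) measurable
  also have "\<dots> = (\<integral>\<^sup>+z\<in>carleson_box I. ennreal (cmod (f z)) * ennreal (\<omega> z) \<partial>lebesgue)"
    using carleson_box_subset_upper_half_plane[of I]
    by (intro nn_integral_cong) (auto simp: zero_extended_cmod_def split: split_indicator)
  finally show ?thesis ..
qed

section \<open>The weighted maximal operator\<close>

text \<open>
  The test function is the indicator of the box. The average of an indicator over its own box is 1
  because the weighted area is neither 0 nor \<open>\<infinity>\<close>.
\<close>

lemma emeasure_carleson_box_le_of_maximal_bound:
  fixes \<mu> :: "complex measure"
  assumes I: "I \<in> bounded_intervals" and pq: "0 < p" "0 < q" and C: "0 < C"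
    and sets_\<mu>: "carleson_box I \<in> sets \<mu>"
    and area: "0 < weighted_area \<omega> (carleson_box I)" "weighted_area \<omega> (carleson_box I) < \<infinity>"
    and bound: "\<And>f. f \<in> wLp p \<omega> \<Longrightarrow>
          (\<integral>\<^sup>+z. weighted_maximal \<omega> f z epowr q \<partial>\<mu>) epowr (1 / q) \<le> ennreal C * wLp_norm p \<omega> f"
  shows "emeasure \<mu> (carleson_box I)
           \<le> ennreal (C powr q) * weighted_area \<omega> (carleson_box I) epowr (q / p)"
proof -
  define W where "W = weighted_area \<omega> (carleson_box I)"
  define f :: "complex \<Rightarrow> complex" where "f = indicator (carleson_box I)"
  have norm_f: "ennreal (cmod (f z)) = indicator (carleson_box I) z" for z
    by (simp add: f_def indicator_def)
  have [measurable]: "carleson_box I \<in> sets lebesgue" by (rule carleson_box_lebesgue[OF I])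
  have f: "f \<in> borel_measurable (lebesgue_on \<H>)"
    unfolding f_def by (intro measurable_restrict_space1) measurable
  have "wLp_norm p \<omega> f = (\<integral>\<^sup>+z\<in>carleson_box I. ennreal (\<omega> z) \<partial>lebesgue) epowr (1 / p)"
    unfolding wLp_norm_def norm_f
    using carleson_box_subset_upper_half_plane[of I] pq
    by (intro arg_cong2[where f = "(epowr)"] nn_integral_cong refl)
       (auto simp: epowr_def split: split_indicator)
  then have norm: "wLp_norm p \<omega> f = W epowr (1 / p)"
    by (simp add: W_def weighted_area_def)
  have "W epowr (1 / p) < \<infinity>"
    using area pq by (cases W) (auto simp: W_def epowr_def)
  with f norm have fLp: "f \<in> wLp p \<omega>" by (simp add: wLp_def)
  have maximal: "1 \<le> weighted_maximal \<omega> f z" if z: "z \<in> carleson_box I" for z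
  proof -
    have "(\<integral>\<^sup>+w\<in>carleson_box I. ennreal (cmod (f w)) * ennreal (\<omega> w) \<partial>lebesgue) = W"
      unfolding W_def weighted_area_def norm_f
      by (intro nn_integral_cong) (auto split: split_indicator)
    then have "1 = (\<integral>\<^sup>+w\<in>carleson_box I. ennreal (cmod (f w)) * ennreal (\<omega> w) \<partial>lebesgue) / W"
      using area by (simp add: W_def ennreal_divide_self less_top)
    also have "\<dots> \<le> weighted_maximal \<omega> f z"
      unfolding weighted_maximal_def W_def using I z by (intro SUP_upper) simp
    finally show ?thesis .
  qed
  have "emeasure \<mu> (carleson_box I) = (\<integral>\<^sup>+z. indicator (carleson_box I) z \<partial>\<mu>)"
    using sets_\<mu> by simp
  also have "\<dots> \<le> (\<integral>\<^sup>+z. weighted_maximal \<omega> f z epowr q \<partial>\<mu>)"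
  proof (rule nn_integral_mono)
    fix z
    show "indicator (carleson_box I) z \<le> weighted_maximal \<omega> f z epowr q"
      using epowr_mono[OF maximal, of z q] pq by (auto split: split_indicator)
  qed
  also have "\<dots> = ((\<integral>\<^sup>+z. weighted_maximal \<omega> f z epowr q \<partial>\<mu>) epowr (1 / q)) epowr q"
    using pq by (simp add: epowr_epowr)
  also have "\<dots> \<le> (ennreal C * W epowr (1 / p)) epowr q"
    using bound[OF fLp] pq by (intro epowr_mono) (auto simp: norm)
  also have "\<dots> = ennreal (C powr q) * W epowr (q / p)"
    using pq C by (simp add: epowr_mult epowr_epowr ennreal_epowr)
  finally show ?thesis by (simp add: W_def)
qed

text \<open>
  If the weighted average of \<open>|f|\<close> over a box exceeds \<open>t\<close>, then by doubling its average over some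
  larger rational box is at least \<open>t / D\<close>, and the boxes with this property make up the set \<open>E\<close>.
  On such a box, the part of \<open>|f|\<close> below the height \<open>t / (2 D)\<close> has average at most \<open>t / (2 D)\<close>,
  so the part above this height has at least the same average and, after scaling, dominates the
  weighted area. The covering estimate applies to these boxes.
\<close>

lemma weighted_maximal_weak_type:
  fixes \<mu> :: "complex measure"
  assumes weight: "weight \<omega>" and f: "f \<in> borel_measurable (lebesgue_on \<H>)"
    and s: "1 \<le> s" and D: "0 < D" and C: "0 \<le> C" and t: "0 < t"
    and sets_\<mu>: "\<And>I. I \<in> bounded_intervals \<Longrightarrow> carleson_box I \<in> sets \<mu>"
    and doubling: "\<And>I J. I \<in> bounded_intervals \<Longrightarrow> J \<in> bounded_intervals \<Longrightarrow> I \<subseteq> J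
            \<Longrightarrow> measure lborel J \<le> 5 * measure lborel I
            \<Longrightarrow> weighted_area \<omega> (carleson_box J) \<le> ennreal D * weighted_area \<omega> (carleson_box I)"
    and positive: "\<And>I. I \<in> bounded_intervals \<Longrightarrow> 0 < weighted_area \<omega> (carleson_box I)"
    and finite: "\<And>I. I \<in> bounded_intervals \<Longrightarrow> weighted_area \<omega> (carleson_box I) < \<infinity>"
    and carleson: "\<And>I. I \<in> bounded_intervals \<Longrightarrow>
          emeasure \<mu> (carleson_box I) \<le> ennreal C * weighted_area \<omega> (carleson_box I) epowr s"
  obtains E where "E \<in> sets \<mu>" "\<And>z. ennreal t < weighted_maximal \<omega> f z \<Longrightarrow> z \<in> E"
    "emeasure \<mu> E \<le> ennreal (C * (2 * D\<^sup>2) powr s) * (ennreal (1 / t) *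
       (\<integral>\<^sup>+w. ennreal (zero_extended_cmod f w) * indicator {w. t / (2 * D) < zero_extended_cmod f w} w
          \<partial>weighted_measure \<omega>)) epowr s"
proof -
  define \<nu> where "\<nu> = weighted_measure \<omega>"
  define F where "F = zero_extended_cmod f"
  define W where "W I = weighted_area \<omega> (carleson_box I)" for I
  define T where "T I = (\<integral>\<^sup>+w\<in>carleson_box I. ennreal (F w) \<partial>\<nu>)" for I
  define g where "g w = ennreal (F w) * indicator {w. t / (2 * D) < F w} w" for w
  have sets_\<nu> [measurable_cong]: "sets \<nu> = sets lebesgue" by (simp add: \<nu>_def)
  have F [measurable]: "F \<in> borel_measurable lebesgue"
    unfolding F_def by (rule zero_extended_cmod_borel_measurable[OF f])
  have g [measurable]: "g \<in> borel_measurable \<nu>"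
    unfolding g_def by measurable
  define K where "K = {(a, r). a \<in> \<rat> \<and> r \<in> \<rat> \<and> 0 < r \<and>
      ennreal t * W (ball a r) \<le> ennreal D * T (ball a r)}"
  have K_subset: "K \<subseteq> \<rat> \<times> \<rat>" by (auto simp: K_def)
  have K: "countable K"
    by (rule countable_subset[OF K_subset]) (intro countable_SIGMA countable_rat)
  define \<tau> where "\<tau> = density \<nu> (\<lambda>w. ennreal (2 * D / t) * g w)"
  have dominated: "W (ball a r) \<le> emeasure \<tau> (carleson_box (ball a r))" if ar: "(a, r) \<in> K" for a r
  proof -
    define I where "I = ball a r"
    have I: "I \<in> bounded_intervals"
      using ar by (auto simp: K_def I_def intro: ball_in_bounded_intervals)
    have [measurable]: "carleson_box I \<in> sets lebesgue" by (rule carleson_box_lebesgue[OF I])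
    define G where "G = (\<integral>\<^sup>+w\<in>carleson_box I. g w \<partial>\<nu>)"
    have "T I \<le> (\<integral>\<^sup>+w. g w * indicator (carleson_box I) w +
        ennreal (t / (2 * D)) * indicator (carleson_box I) w \<partial>\<nu>)"
      unfolding T_def g_def
      by (intro nn_integral_mono) (auto simp: indicator_def ennreal_leI not_less)
    also have "\<dots> = G + ennreal (t / (2 * D)) * W I"
      unfolding G_def W_def \<nu>_def[symmetric]
        emeasure_weighted_measure_carleson_box[OF weight I, symmetric]
      by (subst nn_integral_add) (auto simp: nn_integral_cmult_indicator sets_\<nu>)
    finally have T_le: "T I \<le> G + ennreal (t / (2 * D)) * W I" .
    \<comment> \<open>Half of \<open>t W(I)\<close>: a finite bound for what the small values of \<open>f\<close> contribute, hence cancellable.\<close>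
    define h where "h = ennreal (t / 2) * W I"
    have "h + h = ennreal t * W I"
      unfolding h_def using t by (simp add: distrib_right[symmetric] ennreal_plus[symmetric] del: ennreal_plus)
    also have "\<dots> \<le> ennreal D * T I"
      using ar by (simp add: K_def I_def)
    also have "\<dots> \<le> ennreal D * (G + ennreal (t / (2 * D)) * W I)"
      by (intro mult_left_mono T_le) simp
    also have "\<dots> = h + ennreal D * G"
      using D t by (simp add: h_def distrib_left mult.assoc[symmetric] ennreal_mult'[symmetric] add.commute)
    finally have "h + h \<le> h + ennreal D * G" .
    moreover have "h \<noteq> \<infinity>"
      using finite[OF I] by (auto simp: h_def W_def ennreal_mult_eq_top_iff)
    ultimately have "h \<le> ennreal D * G"
      by (simp add: ennreal_add_left_cancel_le)
    then have "ennreal (2 / t) * h \<le> ennreal (2 / t) * (ennreal D * G)"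
      by (rule mult_left_mono) simp
    also have "\<dots> = ennreal (2 * D / t) * G"
      using t D by (simp add: mult.assoc[symmetric] ennreal_mult'[symmetric])
    also have "ennreal (2 / t) * h = W I"
      using t by (simp add: h_def mult.assoc[symmetric] ennreal_mult'[symmetric])
    also have "ennreal (2 * D / t) * G = emeasure \<tau> (carleson_box I)"
      unfolding \<tau>_def G_def
      by (subst emeasure_density) (auto simp: sets_\<nu> nn_integral_cmult[symmetric] mult.assoc)
    finally show ?thesis by (simp add: I_def)
  qed
  define E where "E = (\<Union>(a, r)\<in>K. carleson_box (ball a r))"
  have "E \<in> sets \<mu>"
    unfolding E_def using K
    by (intro sets.countable_UN')
       (auto simp: K_def intro!: sets_\<mu> ball_in_bounded_intervals)
  moreover have "z \<in> E" if z: "ennreal t < weighted_maximal \<omega> f z" for z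
  proof -
    obtain I where I: "I \<in> bounded_intervals" and zI: "z \<in> carleson_box I"
      and average: "ennreal t < T I / W I"
      using z unfolding weighted_maximal_def less_SUP_iff T_def F_def \<nu>_def W_def
      by (auto simp: nn_integral_weighted_measure_carleson_box[OF weight f])
    obtain a r where ar: "a \<in> \<rat>" "r \<in> \<rat>" "0 < r" "I \<subseteq> ball a r" "r \<le> measure lborel I"
      by (rule subset_rational_ball[OF I])
    have J: "ball a r \<in> bounded_intervals"
      using ar(3) by (rule ball_in_bounded_intervals)
    have sub: "carleson_box I \<subseteq> carleson_box (ball a r)"
      using I J ar(4) by (rule carleson_box_mono)
    have "ennreal t * W I \<le> T I / W I * W I"
      using average by (intro mult_right_mono) auto
    also have "\<dots> = T I"
      using positive[OF I] finite[OF I]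
      by (simp add: ennreal_divide_times W_def ennreal_divide_self less_top)
    also have "\<dots> \<le> T (ball a r)"
      unfolding T_def using sub by (intro nn_integral_mono) (auto simp: indicator_def)
    finally have TI: "ennreal t * W I \<le> T (ball a r)" .
    have "W (ball a r) \<le> ennreal D * W I"
      unfolding W_def using ar by (intro doubling I J) (auto simp: measure_ball_real)
    then have "ennreal t * W (ball a r) \<le> ennreal t * (ennreal D * W I)"
      by (rule mult_left_mono) simp
    also have "\<dots> = ennreal D * (ennreal t * W I)" by (simp add: mult_ac)
    also have "\<dots> \<le> ennreal D * T (ball a r)"
      by (intro mult_left_mono TI) simp
    finally have "(a, r) \<in> K" using ar by (simp add: K_def)
    then show ?thesis using zI sub by (auto simp: E_def)
  qed
  moreover have "emeasure \<mu> E \<le> ennreal (C * (2 * D\<^sup>2) powr s) *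
      (ennreal (1 / t) * (\<integral>\<^sup>+w. g w \<partial>\<nu>)) epowr s"
  proof -
    have "emeasure \<mu> E \<le> ennreal C * (ennreal D * emeasure \<tau> (space \<tau>)) epowr s"
      unfolding E_def
    proof (rule emeasure_UN_carleson_boxes_le[where W = "\<lambda>A. weighted_area \<omega> A"])
      show "weighted_area \<omega> (carleson_box (ball a (5 * r)))
          \<le> ennreal D * weighted_area \<omega> (carleson_box (ball a r))" if "0 < r" for a r
        using that
        by (intro doubling ball_in_bounded_intervals subset_ball) (auto simp: measure_ball_real)
      show "carleson_box I \<in> sets \<tau>" if "I \<in> bounded_intervals" for I
        using carleson_box_lebesgue[OF that] by (simp add: \<tau>_def sets_\<nu>)
      show "weighted_area \<omega> (carleson_box (ball a r)) \<le> emeasure \<tau> (carleson_box (ball a r))"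
        if "(a, r) \<in> K" for a r
        using dominated[OF that] by (simp add: W_def)
    qed (use s K carleson sets_\<mu> in \<open>auto simp: K_def\<close>)
    also have "emeasure \<tau> (space \<tau>) = ennreal (2 * D / t) * (\<integral>\<^sup>+w. g w \<partial>\<nu>)"
      unfolding \<tau>_def by (subst emeasure_density) (auto simp: nn_integral_cmult)
    also have "ennreal D * (ennreal (2 * D / t) * (\<integral>\<^sup>+w. g w \<partial>\<nu>))
        = ennreal (2 * D\<^sup>2) * (ennreal (1 / t) * (\<integral>\<^sup>+w. g w \<partial>\<nu>))"
    proof -
      have "ennreal D * ennreal (2 * D / t) = ennreal (2 * D\<^sup>2) * ennreal (1 / t)"
        using D t by (simp add: ennreal_mult'[symmetric] power2_eq_square mult.commute)
      then show ?thesis by (simp only: mult.assoc[symmetric])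
    qed
    also have "(ennreal (2 * D\<^sup>2) * (ennreal (1 / t) * (\<integral>\<^sup>+w. g w \<partial>\<nu>))) epowr s
        = ennreal ((2 * D\<^sup>2) powr s) * (ennreal (1 / t) * (\<integral>\<^sup>+w. g w \<partial>\<nu>)) epowr s"
      using s D by (subst epowr_mult) (auto simp: ennreal_epowr)
    finally show ?thesis
      using C by (simp add: ennreal_mult' mult.assoc)
  qed
  ultimately show ?thesis
    by (intro that[of E]) (simp_all add: g_def F_def \<nu>_def)
qed

text \<open>
  The weak estimate at the levels \<open>t = 2\<^sup>k\<close> is the hypothesis of the interpolation step with \<open>c =
  1 / (2 D)\<close>.
\<close>

lemma weighted_maximal_strong_type:
  fixes \<mu> :: "complex measure"
  assumes p: "1 < p" and s: "1 \<le> s" and \<omega>: "\<omega> \<in> Bekolle_Bonami p" and C: "0 \<le> C"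
    and sets_\<mu>: "\<And>I. I \<in> bounded_intervals \<Longrightarrow> carleson_box I \<in> sets \<mu>"
    and carleson: "\<And>I. I \<in> bounded_intervals \<Longrightarrow>
          emeasure \<mu> (carleson_box I) \<le> ennreal C * weighted_area \<omega> (carleson_box I) epowr s"
  obtains B :: real where "0 \<le> B"
    "\<And>f. f \<in> borel_measurable (lebesgue_on \<H>) \<Longrightarrow>
       (\<integral>\<^sup>+z. weighted_maximal \<omega> f z epowr (p * s) \<partial>\<mu>)
         \<le> ennreal B * (\<integral>\<^sup>+z\<in>\<H>. ennreal (cmod (f z)) epowr p * ennreal (\<omega> z) \<partial>lebesgue) epowr s"
proof -
  have weight: "weight \<omega>" using \<omega> by (simp add: Bekolle_Bonami_def)
  obtain D :: real where D: "0 < D"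
    "\<And>I J. I \<in> bounded_intervals \<Longrightarrow> J \<in> bounded_intervals \<Longrightarrow> I \<subseteq> J
        \<Longrightarrow> measure lborel J \<le> 5 * measure lborel I
        \<Longrightarrow> weighted_area \<omega> (carleson_box J) \<le> ennreal D * weighted_area \<omega> (carleson_box I)"
    "\<And>I. I \<in> bounded_intervals \<Longrightarrow> 0 < weighted_area \<omega> (carleson_box I)"
    "\<And>I. I \<in> bounded_intervals \<Longrightarrow> weighted_area \<omega> (carleson_box I) < \<infinity>"
    using Bekolle_Bonami_doubling[OF p \<omega>] by blast
  define A where "A = C * (2 * D\<^sup>2) powr s"
  define c where "c = 1 / (2 * D)"
  define B where "B = A * 2 powr (p * s) * c powr ((1 - p) * s) / (1 - 2 powr - (p - 1))"
  have A: "0 \<le> A" using C by (simp add: A_def)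
  have c: "0 < c" using D by (simp add: c_def)
  have "2 powr - (p - 1) < 1" using p by (intro powr_less_one) auto
  then have B: "0 \<le> B" using A by (simp add: B_def)
  have "(\<integral>\<^sup>+z. weighted_maximal \<omega> f z epowr (p * s) \<partial>\<mu>)
         \<le> ennreal B * (\<integral>\<^sup>+z\<in>\<H>. ennreal (cmod (f z)) epowr p * ennreal (\<omega> z) \<partial>lebesgue) epowr s"
    if f: "f \<in> borel_measurable (lebesgue_on \<H>)" for f
  proof -
    note [measurable] = zero_extended_cmod_borel_measurable[OF f]
    define good where "good k E \<longleftrightarrow> E \<in> sets \<mu> \<and>
        (\<forall>z. ennreal (2 powr real_of_int k) < weighted_maximal \<omega> f z \<longrightarrow> z \<in> E) \<and>
        emeasure \<mu> E \<le> ennreal A * (ennreal (2 powr - real_of_int k) *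
          (\<integral>\<^sup>+w. ennreal (zero_extended_cmod f w) * indicator {w. c * 2 powr real_of_int k < zero_extended_cmod f w} w
            \<partial>weighted_measure \<omega>)) epowr s" for k :: int and E
    have "\<exists>E. good k E" for k
    proof -
      obtain E where "E \<in> sets \<mu>" "\<And>z. ennreal (2 powr real_of_int k) < weighted_maximal \<omega> f z \<Longrightarrow> z \<in> E"
        "emeasure \<mu> E \<le> ennreal (C * (2 * D\<^sup>2) powr s) * (ennreal (1 / 2 powr real_of_int k) *
           (\<integral>\<^sup>+w. ennreal (zero_extended_cmod f w) *
              indicator {w. 2 powr real_of_int k / (2 * D) < zero_extended_cmod f w} w
              \<partial>weighted_measure \<omega>)) epowr s"
        by (rule weighted_maximal_weak_type[OF weight f s D(1) C _ sets_\<mu> D(2-4) carleson,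
              where t = "2 powr real_of_int k"]) auto
      then show ?thesis
        by (intro exI[of _ E]) (simp add: good_def A_def c_def powr_minus_divide)
    qed
    then obtain E where "\<And>k. good k (E k)" by metis
    note E = this[unfolded good_def]
    have "zero_extended_cmod f \<in> borel_measurable (weighted_measure \<omega>)" by measurable
    then have "(\<integral>\<^sup>+z. weighted_maximal \<omega> f z epowr (p * s) \<partial>\<mu>)
        \<le> ennreal B * (\<integral>\<^sup>+w. ennreal (zero_extended_cmod f w powr p) \<partial>weighted_measure \<omega>) epowr s"
      unfolding B_def using E
      by (intro nn_integral_epowr_le_of_dyadic_weak_type[OF p s c A, where E = E])
         (auto simp: zero_extended_cmod_nonneg)
    also have "(\<integral>\<^sup>+w. ennreal (zero_extended_cmod f w powr p) \<partial>weighted_measure \<omega>)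
        = (\<integral>\<^sup>+z\<in>\<H>. ennreal (zero_extended_cmod f z powr p) * ennreal (\<omega> z) \<partial>lebesgue)"
      by (rule nn_integral_weighted_measure[OF weight]) measurable
    also have "\<dots> = (\<integral>\<^sup>+z\<in>\<H>. ennreal (cmod (f z)) epowr p * ennreal (\<omega> z) \<partial>lebesgue)"
      using p by (intro nn_integral_cong) (auto simp: zero_extended_cmod_def ennreal_epowr split: split_indicator)
    finally show ?thesis .
  qed
  with B show ?thesis by (rule that)
qed

theorem theorem1p1:
  fixes p q :: real and \<omega> :: "complex \<Rightarrow> real" and \<mu> :: "complex measure"
  assumes "1 < p" and "p \<le> q"
    and "weight \<omega>" and "\<omega> \<in> Bekolle_Bonami p"
    and "sets \<mu> = sets (restrict_space borel \<H>)"
  shows "(\<exists>C\<^sub>1::real. 0 < C\<^sub>1 \<and>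
            (\<forall>f\<in>wLp p \<omega>.
               (\<integral>\<^sup>+z. weighted_maximal \<omega> f z epowr q \<partial>\<mu>) epowr (1 / q)
                 \<le> ennreal C\<^sub>1 * wLp_norm p \<omega> f))
     \<longleftrightarrow> (\<exists>C\<^sub>2::real. 0 \<le> C\<^sub>2 \<and>
            (\<forall>I\<in>bounded_intervals.
               emeasure \<mu> (carleson_box I)
                 \<le> ennreal C\<^sub>2 * weighted_area \<omega> (carleson_box I) epowr (q / p)))"
    (is "?maximal \<longleftrightarrow> ?carleson")
proof
  have sets_\<mu>: "carleson_box I \<in> sets \<mu>" if "I \<in> bounded_intervals" for I
    unfolding assms(5) sets_restrict_space
    using carleson_box_borel[OF that] carleson_box_subset_upper_half_plane[of I] by blast
  {
    assume ?maximal
    then obtain C where C: "0 < C" "\<And>f. f \<in> wLp p \<omega> \<Longrightarrow>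
        (\<integral>\<^sup>+z. weighted_maximal \<omega> f z epowr q \<partial>\<mu>) epowr (1 / q) \<le> ennreal C * wLp_norm p \<omega> f"
      by blast
    have area: "0 < weighted_area \<omega> (carleson_box I)" "weighted_area \<omega> (carleson_box I) < \<infinity>"
      if "I \<in> bounded_intervals" for I
      using Bekolle_Bonami_doubling[OF assms(1,4)] that by blast+
    show ?carleson
      using assms(1,2) C area sets_\<mu>
      by (intro exI[of _ "C powr q"] conjI ballI emeasure_carleson_box_le_of_maximal_bound) auto
  }
  {
    assume ?carleson
    then obtain C where C: "0 \<le> C" "\<And>I. I \<in> bounded_intervals \<Longrightarrow>
        emeasure \<mu> (carleson_box I) \<le> ennreal C * weighted_area \<omega> (carleson_box I) epowr (q / p)"
      by blast
    have s: "1 \<le> q / p" using assms(1,2) by simp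
    obtain B :: real where B: "0 \<le> B"
      "\<And>f. f \<in> borel_measurable (lebesgue_on \<H>) \<Longrightarrow>
         (\<integral>\<^sup>+z. weighted_maximal \<omega> f z epowr (p * (q / p)) \<partial>\<mu>)
           \<le> ennreal B * (\<integral>\<^sup>+z\<in>\<H>. ennreal (cmod (f z)) epowr p * ennreal (\<omega> z) \<partial>lebesgue) epowr (q / p)"
      using weighted_maximal_strong_type[OF assms(1) s assms(4) C(1) sets_\<mu> C(2)] by blast
    \<comment> \<open>The summand 1 below keeps the constant positive in case \<open>B = 0\<close>.\<close>
    show ?maximal
    proof (intro exI[of _ "B powr (1 / q) + 1"] conjI ballI)
      show "0 < B powr (1 / q) + 1" by (rule add_nonneg_pos) auto
      fix f assume f: "f \<in> wLp p \<omega>"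
      define N where "N = (\<integral>\<^sup>+z\<in>\<H>. ennreal (cmod (f z)) epowr p * ennreal (\<omega> z) \<partial>lebesgue)"
      have "(\<integral>\<^sup>+z. weighted_maximal \<omega> f z epowr q \<partial>\<mu>) \<le> ennreal B * N epowr (q / p)"
        using B(2)[of f] f assms(1) by (simp add: wLp_def N_def)
      then have "(\<integral>\<^sup>+z. weighted_maximal \<omega> f z epowr q \<partial>\<mu>) epowr (1 / q)
          \<le> (ennreal B * N epowr (q / p)) epowr (1 / q)"
        using assms(1,2) by (intro epowr_mono) auto
      also have "\<dots> = ennreal (B powr (1 / q)) * N epowr (1 / p)"
        using assms(1,2) B(1) by (simp add: epowr_mult epowr_epowr ennreal_epowr)
      also have "\<dots> \<le> ennreal (B powr (1 / q) + 1) * wLp_norm p \<omega> f"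
        unfolding wLp_norm_def N_def by (intro mult_right_mono ennreal_leI) auto
      finally show "(\<integral>\<^sup>+z. weighted_maximal \<omega> f z epowr q \<partial>\<mu>) epowr (1 / q)
          \<le> ennreal (B powr (1 / q) + 1) * wLp_norm p \<omega> f" .
    qed
  }
qed

end
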